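(* Let $\mathcal{H}(T,A,\mu)$ be a Cauchy--de Branges space of finite order. Let $$G(z)=A(z)\Big(\gamma+\sum_n\frac{a_n}{z-t_n}\Big),$$ where $\gamma\in\mathbb{C}\setminus\{0\}$ and $(a_n)\subset\mathbb{C}$ satisfies $\sum_n\frac{|a_n|}{|t_n|+1}<\infty$. Then $\mathcal{Z}(G)$ (counting multiplicities) is a uniqueness set for $\mathcal{H}(T,A,\mu)$: the only function in the space vanishing on $\mathcal{Z}(G)$ with at least the corresponding multiplicities is $0$.
   Context: Let $T=\{t_n\}_{n\ge1}\subset\mathbb{C}$ be a set of distinct points with $|t_n|\to\infty$, and let $\mu_n>0$ satisfy $\sum_n\frac{\mu_n}{|t_n|^2+1}<\infty$. Let $A$ be an entire function with simple zeros exactly at $T$ and no other zeros. The Cauchy--de Branges space is $\mathcal{H}(T,A,\mu)=\{F(z)=A(z)\sum_n\frac{c_n\mu_n^{1/2}}{z-t_n}:(c_n)\in\ell^2\}$ with norm $\|F\|=\|(c_n)\|_{\ell^2}$. It is of finite order if all its elements are entire functions of finite order (equivalently, $A$ has finite order). *)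

theory Defs
  imports "HOL-Complex_Analysis.Complex_Analysis"
begin

definition entire_finite_order :: "(complex \<Rightarrow> complex) \<Rightarrow> bool" where
  "entire_finite_order f \<longleftrightarrow> f holomorphic_on UNIV \<and>
     (\<exists>\<rho>::real. \<exists>R::real. \<forall>z. norm z \<ge> R \<longrightarrow> norm (f z) \<le> exp (norm z powr \<rho>))"

text \<open>The Cauchy--de Branges space H(T,A,mu) as a set of entire functions.
  The defining formula A(z) * sum_n c_n mu_n^(1/2) / (z - t_n) is imposed off T;
  at the points t_n the element is the (unique) entire extension.\<close>
definition CdB_space ::
  "(nat \<Rightarrow> complex) \<Rightarrow> (complex \<Rightarrow> complex) \<Rightarrow> (nat \<Rightarrow> real) \<Rightarrow> (complex \<Rightarrow> complex) set" where
  "CdB_space t A \<mu> = {F. \<exists>c::nat \<Rightarrow> complex. summable (\<lambda>n. (cmod (c n))\<^sup>2) \<and>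
      F holomorphic_on UNIV \<and>
      (\<forall>z. z \<notin> range t \<longrightarrow>
          F z = A z * (\<Sum>n. c n * complex_of_real (sqrt (\<mu> n)) / (z - t n)))}"

end

(* Write F = A f and G = A g, where f and g - gamma are Cauchy transforms of discrete measures.
   The vanishing hypothesis makes H = F / G = f / g entire. By Kolmogorov's L^(1/2)
   bound for Cauchy transforms, the means of sqrt |f| and sqrt |g - gamma| over the circle |z| = R tend to 0,
   so |H| <= 1 outside a small part of the circle, and Jensen's inequality shows that
   u(r) = max over |z| <= r of log^+ |H| satisfies u(r) <= eps u(4r) for all large r. Jensen's formula for
   log |G| bounds the mean of log^+ (1 / |G|) and hence shows that H has finite order; iterating the
   inequality then gives u = 0. So H is a bounded entire function, hence a constant k, and f = k g compares
   the limit 0 of f with the limit k gamma of k g in the mean, so k = 0. *)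
theory Submission
  imports Defs
begin

section \<open>Circle means and the Poisson integral\<close>

text \<open>The poles \<open>t n\<close> may lie arbitrarily close to a circle, so the modulus of a
  Cauchy transform has neither a useful pointwise bound nor a uniformly bounded mean there. An
  exponent below 1 cures this; for 1/2 the principal square root of a function with positive real
  part does all the work. Circles are chosen free of zeros, so ln |f| is continuous on them and
  every mean is the integral of a continuous function. Points with |z| \<le> r are compared with a
  circle of radius R, 2 r < R < 4 r: the lower bound keeps the Poisson kernel between 1/3 and 3, the
  upper bound lets u(4 r) control the circle, and the gap leaves room to avoid countably many bad
  radii. Finite order decides how small eps must be: if u grows at most like r^m, then eps^k has to
  beat (4^k r)^m.\<close>

definition cmean :: "(complex \<Rightarrow> real) \<Rightarrow> real" where
  "cmean \<phi> = integral {0..1} (\<lambda>x. \<phi> (circlepath 0 1 x))"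

lemma circlepath_in_unit_sphere: "circlepath 0 1 x \<in> sphere 0 1"
  by (simp add: circlepath norm_mult)

lemma continuous_on_circlepath: "continuous_on S (circlepath z r)"
  unfolding circlepath by (intro continuous_intros)

lemma cmean_integrable:
  fixes \<phi> :: "complex \<Rightarrow> real"
  assumes "continuous_on (sphere 0 1) \<phi>"
  shows "(\<lambda>x. \<phi> (circlepath 0 1 x)) integrable_on {0..1::real}"
proof (rule integrable_continuous_interval)
  show "continuous_on {0..1::real} (\<lambda>x. \<phi> (circlepath 0 1 x))"
    by (rule continuous_on_compose2[OF assms continuous_on_circlepath])
       (use circlepath_in_unit_sphere in blast)
qed

lemma cmean_mono:
  assumes "continuous_on (sphere 0 1) \<phi>" "continuous_on (sphere 0 1) \<psi>"
    and "\<And>\<zeta>. norm \<zeta> = 1 \<Longrightarrow> \<phi> \<zeta> \<le> \<psi> \<zeta>"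
  shows "cmean \<phi> \<le> cmean \<psi>"
  unfolding cmean_def using circlepath_in_unit_sphere
  by (intro integral_le cmean_integrable assms) auto

lemma cmean_cong: "(\<And>\<zeta>. norm \<zeta> = 1 \<Longrightarrow> \<phi> \<zeta> = \<psi> \<zeta>) \<Longrightarrow> cmean \<phi> = cmean \<psi>"
  unfolding cmean_def using circlepath_in_unit_sphere by (intro integral_cong) auto

lemma cmean_add:
  assumes "continuous_on (sphere 0 1) \<phi>" "continuous_on (sphere 0 1) \<psi>"
  shows "cmean (\<lambda>\<zeta>. \<phi> \<zeta> + \<psi> \<zeta>) = cmean \<phi> + cmean \<psi>"
  unfolding cmean_def by (intro integral_add cmean_integrable assms)

lemma cmean_diff:
  assumes "continuous_on (sphere 0 1) \<phi>" "continuous_on (sphere 0 1) \<psi>"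
  shows "cmean (\<lambda>\<zeta>. \<phi> \<zeta> - \<psi> \<zeta>) = cmean \<phi> - cmean \<psi>"
  unfolding cmean_def by (intro integral_diff cmean_integrable assms)

lemma cmean_cmul: "cmean (\<lambda>\<zeta>. c * \<phi> \<zeta>) = c * cmean \<phi>"
  unfolding cmean_def by simp

lemma cmean_const: "cmean (\<lambda>\<zeta>. c) = c"
  unfolding cmean_def by simp

lemma cmean_nonneg:
  assumes "continuous_on (sphere 0 1) \<phi>" "\<And>\<zeta>. norm \<zeta> = 1 \<Longrightarrow> 0 \<le> \<phi> \<zeta>"
  shows "0 \<le> cmean \<phi>"
  using cmean_mono[of "\<lambda>_. 0" \<phi>] assms by (simp add: cmean_const)

definition poisson :: "complex \<Rightarrow> complex \<Rightarrow> real" where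
  "poisson z \<zeta> = (1 - (norm z)\<^sup>2) / (norm (\<zeta> - z))\<^sup>2"

lemma continuous_on_poisson:
  assumes "norm z < 1"
  shows "continuous_on (sphere 0 1) (poisson z)"
  unfolding poisson_def using assms by (intro continuous_intros) auto

lemma poisson_nonneg: "norm z < 1 \<Longrightarrow> 0 \<le> poisson z \<zeta>"
  unfolding poisson_def by (simp add: power_le_one)

text \<open>Harnack's bounds: the kernel lies between (1 - |z|) / (1 + |z|) and its reciprocal,
  which are 1/3 and 3 at |z| = 1/2. The factors 3 and 9 in the later estimates originate
  here.\<close>

lemma poisson_le:
  assumes "norm z \<le> 1/2" "norm \<zeta> = 1"
  shows "poisson z \<zeta> \<le> 3"
proof -
  have 1: "norm (\<zeta> - z) \<ge> 1 - norm z" using norm_triangle_ineq2[of \<zeta> z] assms by simp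
  have "1 - (norm z)\<^sup>2 \<le> 3 * (1 - norm z)\<^sup>2"
  proof -
    have "3 * (1 - norm z)\<^sup>2 - (1 - (norm z)\<^sup>2) = (1 - norm z) * (2 - 4 * norm z)"
      by (simp add: power2_eq_square algebra_simps)
    also have "\<dots> \<ge> 0" using assms by (intro mult_nonneg_nonneg) auto
    finally show ?thesis by simp
  qed
  also have "\<dots> \<le> 3 * (norm (\<zeta> - z))\<^sup>2" using 1 assms by (intro mult_left_mono power_mono) auto
  finally show ?thesis
    unfolding poisson_def using 1 assms by (subst pos_divide_le_eq) auto
qed

lemma poisson_ge:
  assumes "norm z \<le> 1/2" "norm \<zeta> = 1"
  shows "poisson z \<zeta> \<ge> 1/3"
proof -
  have 1: "norm (\<zeta> - z) \<ge> 1 - norm z" using norm_triangle_ineq2[of \<zeta> z] assms by simp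
  have 2: "norm (\<zeta> - z) \<le> 1 + norm z" using norm_triangle_ineq4[of \<zeta> z] assms by simp
  have "1/3 * (norm (\<zeta> - z))\<^sup>2 \<le> 1/3 * (1 + norm z)\<^sup>2" using 2 by (intro mult_left_mono power_mono) auto
  also have "\<dots> \<le> 1 - (norm z)\<^sup>2"
  proof -
    have "(1 - (norm z)\<^sup>2) - 1/3 * (1 + norm z)\<^sup>2 = (1 + norm z) * (2 - 4 * norm z) / 3"
      by (simp add: power2_eq_square field_simps)
    also have "\<dots> \<ge> 0" using assms by auto
    finally show ?thesis by simp
  qed
  finally show ?thesis
    unfolding poisson_def using 1 assms by (subst pos_le_divide_eq) auto
qed

lemma poisson_integral:
  assumes contf: "continuous_on (cball 0 1) f" and holf: "f holomorphic_on ball 0 1"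
    and z: "norm z < 1"
  shows "((\<lambda>x. f (circlepath 0 1 x) * of_real (poisson z (circlepath 0 1 x))) has_integral f z) {0..1}"
proof -
  let ?\<zeta> = "circlepath 0 1 :: real \<Rightarrow> complex"
  have vd: "vector_derivative ?\<zeta> (at x) = 2 * of_real pi * \<i> * ?\<zeta> x" for x
    by (subst vector_derivative_circlepath) (simp add: circlepath)
  have nz: "1 - cnj z * \<zeta> \<noteq> 0" if "norm \<zeta> \<le> 1" for \<zeta>
  proof
    assume "1 - cnj z * \<zeta> = 0"
    then have "norm (cnj z * \<zeta>) = 1" by (metis norm_one right_minus_eq)
    moreover have "norm z * norm \<zeta> \<le> norm z * 1" using that by (intro mult_left_mono) auto
    ultimately show False using z by (simp add: norm_mult)
  qed
  have 1: "((\<lambda>u. f u/(u-z)) has_contour_integral (2 * of_real pi * \<i> * f z)) (circlepath 0 1)"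
    using z by (intro Cauchy_integral_circlepath[OF contf holf]) auto
  \<comment> \<open>Adding a kernel whose Cauchy integral vanishes turns the Cauchy kernel into the Poisson kernel.\<close>
  define k where "k = (\<lambda>u. u * (f u * cnj z / (1 - cnj z * u)))"
  have "((\<lambda>u. k u/(u-0)) has_contour_integral (2 * of_real pi * \<i> * k 0)) (circlepath 0 1)"
    unfolding k_def using nz
    by (intro Cauchy_integral_circlepath continuous_intros contf holomorphic_intros holf) auto
  then have "((\<lambda>u. f u/(u-z) + k u/(u-0)) has_contour_integral (2 * of_real pi * \<i> * f z)) (circlepath 0 1)"
    using has_contour_integral_add[OF 1] by (fastforce simp: k_def)
  then have "((\<lambda>x. (f (?\<zeta> x)/(?\<zeta> x-z) + k (?\<zeta> x)/(?\<zeta> x-0)) * (2 * of_real pi * \<i> * ?\<zeta> x)) has_integral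
       2 * of_real pi * \<i> * f z) {0..1}"
    unfolding has_contour_integral vd .
  from has_integral_mult_right[OF this, of "1/(2 * of_real pi * \<i>)"]
  have "((\<lambda>x. 1/(2 * of_real pi * \<i>) * ((f (?\<zeta> x)/(?\<zeta> x-z) + k (?\<zeta> x)/(?\<zeta> x-0)) * (2 * of_real pi * \<i> * ?\<zeta> x)))
          has_integral f z) {0..1}"
    by simp
  moreover have "1/(2 * of_real pi * \<i>) * ((f (?\<zeta> x)/(?\<zeta> x-z) + k (?\<zeta> x)/(?\<zeta> x-0)) * (2 * of_real pi * \<i> * ?\<zeta> x))
      = f (?\<zeta> x) * of_real (poisson z (?\<zeta> x))" for x
  proof -
    define \<zeta> where "\<zeta> = ?\<zeta> x"
    have n: "norm \<zeta> = 1" using circlepath_in_unit_sphere[of x] by (simp add: \<zeta>_def)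
    then have c: "\<zeta> * cnj \<zeta> = 1" by (simp add: complex_norm_square[symmetric])
    have c2: "2 * of_real pi * \<i> \<noteq> (0::complex)" by simp
    have nz0: "\<zeta> \<noteq> 0" using n by auto
    have nz1: "\<zeta> - z \<noteq> 0" using n z by auto
    then have nz2: "cnj \<zeta> - cnj z \<noteq> 0" by (metis complex_cnj_diff complex_cnj_zero_iff)
    \<comment> \<open>On the circle \<open>cnj \<zeta>\<close> is the inverse of
      \<open>\<zeta>\<close>, so the added kernel becomes
      \<open>cnj z / (cnj \<zeta> - cnj z)\<close> and the two numerators combine to 1 -
      |z|^2.\<close>
    have e1: "1 - cnj z * \<zeta> = \<zeta> * (cnj \<zeta> - cnj z)" using c by (simp add: algebra_simps)
    have "\<zeta> / (\<zeta> - z) + \<zeta> * cnj z / (1 - cnj z * \<zeta>) = \<zeta> / (\<zeta> - z) + cnj z / (cnj \<zeta> - cnj z)"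
      unfolding e1 using nz0 by simp
    also have "\<dots> = (\<zeta> * (cnj \<zeta> - cnj z) + cnj z * (\<zeta> - z)) / ((\<zeta> - z) * (cnj \<zeta> - cnj z))"
      using nz1 nz2 by (simp add: add_frac_eq)
    also have "\<dots> = (1 - z * cnj z) / ((\<zeta> - z) * cnj (\<zeta> - z))"
      using c by (simp add: algebra_simps)
    also have "\<dots> = of_real (poisson z \<zeta>)"
      unfolding poisson_def complex_norm_square[symmetric] by simp
    finally have P: "\<zeta> / (\<zeta> - z) + \<zeta> * cnj z / (1 - cnj z * \<zeta>) = of_real (poisson z \<zeta>)" .
    have "k \<zeta>/(\<zeta>-0) = f \<zeta> * cnj z / (1 - cnj z * \<zeta>)"
      unfolding k_def using nz0 by simp
    then have main: "(f \<zeta>/(\<zeta>-z) + k \<zeta>/(\<zeta>-0)) * \<zeta> = f \<zeta> * of_real (poisson z \<zeta>)"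
      unfolding P[symmetric]
      by (simp add: algebra_simps)
    have gen: "1/c * (X * (c * Y)) = X * Y" if "c \<noteq> 0" for c X Y :: complex
      using that by simp
    note gen[OF c2, of "f \<zeta>/(\<zeta>-z) + k \<zeta>/(\<zeta>-0)" \<zeta>]
    also note main
    finally show ?thesis
      unfolding \<zeta>_def[symmetric] .
  qed
  ultimately show ?thesis by simp
qed

lemma poisson_integral_Re:
  assumes "continuous_on (cball 0 1) f" "f holomorphic_on ball 0 1" "norm z < 1"
  shows "cmean (\<lambda>\<zeta>. poisson z \<zeta> * Re (f \<zeta>)) = Re (f z)"
  using has_integral_Re[OF poisson_integral[OF assms]]
  unfolding cmean_def by (simp add: integral_unique mult.commute)

lemma mean_value_Re:
  assumes "continuous_on (cball 0 1) f" "f holomorphic_on ball 0 1"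
  shows "cmean (\<lambda>\<zeta>. Re (f \<zeta>)) = Re (f 0)"
proof -
  have "cmean (\<lambda>\<zeta>. poisson 0 \<zeta> * Re (f \<zeta>)) = cmean (\<lambda>\<zeta>. Re (f \<zeta>))"
    by (rule cmean_cong) (simp add: poisson_def)
  then show ?thesis using poisson_integral_Re[OF assms, of 0] by simp
qed

section \<open>The Poisson--Jensen inequality\<close>

text \<open>On the contractible closed disc a zero-free function has a holomorphic logarithm
  \<open>g\<close>, and ln |f| = Re g is harmonic.\<close>

lemma ln_norm_poisson_eq:
  assumes holf: "f holomorphic_on cball 0 1"
    and nz: "\<And>w. norm w \<le> 1 \<Longrightarrow> f w \<noteq> 0" and z: "norm z < 1"
  shows "cmean (\<lambda>\<zeta>. poisson z \<zeta> * ln (norm (f \<zeta>))) = ln (norm (f z))"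
proof -
  obtain g where g: "g holomorphic_on cball 0 1" "\<And>w. w \<in> cball 0 1 \<Longrightarrow> f w = exp (g w)"
    using contractible_imp_holomorphic_log[OF holf] nz
    by (metis convex_cball convex_imp_contractible mem_cball_0)
  have "cmean (\<lambda>\<zeta>. poisson z \<zeta> * Re (g \<zeta>)) = Re (g z)"
    using g(1) z by (intro poisson_integral_Re holomorphic_on_imp_continuous_on)
      (auto intro: holomorphic_on_subset)
  moreover have "cmean (\<lambda>\<zeta>. poisson z \<zeta> * Re (g \<zeta>)) = cmean (\<lambda>\<zeta>. poisson z \<zeta> * ln (norm (f \<zeta>)))"
    by (rule cmean_cong) (simp add: g(2))
  ultimately show ?thesis using z by (simp add: g(2))
qed

lemma ln_norm_linear_poisson:
  assumes a: "norm a < 1" and z: "norm z < 1" "z \<noteq> a"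
  shows "ln (norm (z - a)) \<le> cmean (\<lambda>\<zeta>. poisson z \<zeta> * ln (norm (\<zeta> - a)))"
proof -
  have nz: "1 - cnj a * w \<noteq> 0" if "norm w \<le> 1" for w
  proof
    assume "1 - cnj a * w = 0"
    then have "norm (cnj a * w) = 1" by (metis norm_one right_minus_eq)
    moreover have "norm a * norm w \<le> norm a * 1" using that by (intro mult_left_mono) auto
    ultimately show False using a by (simp add: norm_mult)
  qed
  \<comment> \<open>\<open>1 - cnj a * \<zeta>\<close> has no zeros in the disc and agrees with \<open>\<zeta> - a\<close> in modulus on the circle.\<close>
  have "(norm (1 - cnj a * z))\<^sup>2 - (norm (z - a))\<^sup>2 = (1 - (norm a)\<^sup>2) * (1 - (norm z)\<^sup>2)"
    unfolding cmod_power2 by (simp add: power2_eq_square algebra_simps)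
  also have "\<dots> \<ge> 0" using a z by (simp add: power_le_one)
  finally have "(norm (z - a))\<^sup>2 \<le> (norm (1 - cnj a * z))\<^sup>2" by simp
  then have "norm (z - a) \<le> norm (1 - cnj a * z)"
    by (rule power2_le_imp_le) simp
  then have "ln (norm (z - a)) \<le> ln (norm (1 - cnj a * z))"
    using z by (subst ln_le_cancel_iff) auto
  also have "\<dots> = cmean (\<lambda>\<zeta>. poisson z \<zeta> * ln (norm (1 - cnj a * \<zeta>)))"
    using nz z by (intro ln_norm_poisson_eq[symmetric] holomorphic_intros) auto
  also have "\<dots> = cmean (\<lambda>\<zeta>. poisson z \<zeta> * ln (norm (\<zeta> - a)))"
  proof (rule cmean_cong)
    fix \<zeta> :: complex assume n: "norm \<zeta> = 1"
    then have "\<zeta> * cnj \<zeta> = 1" by (simp add: complex_norm_square[symmetric])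
    then have "1 - cnj a * \<zeta> = \<zeta> * cnj (\<zeta> - a)" by (simp add: algebra_simps)
    then have "norm (1 - cnj a * \<zeta>) = norm (\<zeta> - a)" 
      using n by (metis complex_mod_cnj mult_1 norm_mult)
    then show "poisson z \<zeta> * ln (norm (1 - cnj a * \<zeta>)) = poisson z \<zeta> * ln (norm (\<zeta> - a))" by simp
  qed
  finally show ?thesis .
qed

text \<open>The local factorisation at a zero becomes global because f(w) / (w - a)^m has only a
  removable singularity at a. The cofactor has to be entire again for the induction over zeros
  below.\<close>

lemma entire_factor_zero:
  assumes holf: "f holomorphic_on UNIV" and ne: "f b \<noteq> 0" and a: "f a = 0"
  obtains g m where "g holomorphic_on UNIV" "g a \<noteq> 0" "\<And>w. f w = (w - a) ^ m * g w"
proof -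
  have ex: "\<exists>w\<in>UNIV. f w \<noteq> 0" using ne by blast
  define m where "m = nat (zorder f a)"
  define P where "P = zor_poly f a"
  obtain r where m: "m \<noteq> 0" and r: "r > 0" "P holomorphic_on cball a r"
      "\<And>w. w \<in> cball a r \<Longrightarrow> f w = P w * (w - a) ^ m \<and> P w \<noteq> 0"
    using zorder_exist_zero[OF holf open_UNIV connected_UNIV UNIV_I ex, of a] a
    unfolding m_def P_def by auto
  define g where "g = (\<lambda>w. if w = a then P a else f w / (w - a) ^ m)"
  have "isCont P a"
    using r by (intro continuous_on_interior[OF holomorphic_on_imp_continuous_on[OF r(2)]])
      (simp add: interior_cball)
  then have "P \<midarrow>a\<rightarrow> P a" by (simp add: isCont_def)
  moreover have "\<forall>\<^sub>F w in at a. P w = f w / (w - a) ^ m"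
    unfolding eventually_at using r by (intro exI[of _ r]) (auto simp: dist_commute)
  ultimately have lim: "(\<lambda>w. f w / (w - a) ^ m) \<midarrow>a\<rightarrow> P a"
    by (rule Lim_transform_eventually)
  have "g holomorphic_on UNIV"
    unfolding g_def
    by (intro removable_singularity[OF _ open_UNIV lim] holomorphic_intros
        holomorphic_on_subset[OF holf]) auto
  moreover have "g a \<noteq> 0" using r(3)[of a] r(1) by (simp add: g_def)
  moreover have "f w = (w - a) ^ m * g w" for w using m a by (simp add: g_def)
  ultimately show ?thesis using that by blast
qed

text \<open>Induction on the finite set of zeros in the closed disc: dividing out one zero with its
  full multiplicity shrinks the set, the linear factors obey the inequality, and a zero-free
  function gives equality. The absence of zeros on the circle keeps the integrands
  continuous.\<close>

lemma ln_norm_le_poisson: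
  assumes "f holomorphic_on UNIV" and "\<And>w. norm w = 1 \<Longrightarrow> f w \<noteq> 0" and z: "norm z < 1" "f z \<noteq> 0"
  shows "ln (norm (f z)) \<le> cmean (\<lambda>\<zeta>. poisson z \<zeta> * ln (norm (f \<zeta>)))"
proof -
  have "finite {w \<in> cball 0 1. f w = 0}"
  proof (cases "f constant_on UNIV")
    case True
    then have "{w \<in> cball 0 1. f w = 0} = {}" using z(2) unfolding constant_on_def by auto
    then show ?thesis by (simp only: finite.emptyI)
  next
    case False
    then show ?thesis by (intro holomorphic_compact_finite_zeros[OF assms(1)]) auto
  qed
  then show ?thesis using assms(1,2) z(2)
  proof (induction "{w \<in> cball 0 1. f w = 0}" arbitrary: f rule: finite_psubset_induct)
    case (psubset f)
    show ?case
    proof (cases "\<exists>a. norm a \<le> 1 \<and> f a = 0")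
      case False
      then show ?thesis 
        using ln_norm_poisson_eq[OF holomorphic_on_subset[OF psubset.prems(1)], of z] z(1) by force
    next
      case True
      then obtain a where a: "norm a \<le> 1" "f a = 0" by blast
      with psubset.prems have a1: "norm a < 1" by force
      obtain g m where g: "g holomorphic_on UNIV" "g a \<noteq> 0" and fg: "\<And>w. f w = (w - a) ^ m * g w"
        using entire_factor_zero[OF psubset.prems(1) psubset.prems(3) a(2)] by metis
      have "m \<noteq> 0" using fg[of a] a g by (cases "m = 0") auto
      have sub: "{w \<in> cball 0 1. g w = 0} \<subset> {w \<in> cball 0 1. f w = 0}"
        using fg g a \<open>m \<noteq> 0\<close> by (auto simp: psubset_eq)
      have gs: "g w \<noteq> 0" if "norm w = 1" for w using psubset.prems(2)[OF that] fg[of w] by auto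
      have gz: "g z \<noteq> 0" and za: "z \<noteq> a" using psubset.prems(3) fg[of z] a(2) by auto
      have IH: "ln (norm (g z)) \<le> cmean (\<lambda>\<zeta>. poisson z \<zeta> * ln (norm (g \<zeta>)))"
        using psubset.hyps(2)[OF sub g(1) gs gz] .
      have ca: "continuous_on (sphere 0 1) (\<lambda>\<zeta>. poisson z \<zeta> * ln (norm (\<zeta> - a)))"
        using a1 by (intro continuous_intros continuous_on_poisson z) auto
      have cg: "continuous_on (sphere 0 1) (\<lambda>\<zeta>. poisson z \<zeta> * ln (norm (g \<zeta>)))"
        using gs g by (intro continuous_intros continuous_on_poisson z
          continuous_on_subset[OF holomorphic_on_imp_continuous_on[OF g(1)]]) auto
      have "ln (norm (f z)) = real m * ln (norm (z - a)) + ln (norm (g z))"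
        using za gz by (simp add: fg norm_mult norm_power ln_mult ln_realpow)
      also have "\<dots> \<le> real m * cmean (\<lambda>\<zeta>. poisson z \<zeta> * ln (norm (\<zeta> - a)))
           + cmean (\<lambda>\<zeta>. poisson z \<zeta> * ln (norm (g \<zeta>)))"
        by (intro add_mono mult_left_mono IH ln_norm_linear_poisson a1 z za) auto
      also have "\<dots> = cmean (\<lambda>\<zeta>. real m * (poisson z \<zeta> * ln (norm (\<zeta> - a))) + poisson z \<zeta> * ln (norm (g \<zeta>)))"
        using ca cg by (subst cmean_add) (auto simp: cmean_cmul intro!: continuous_intros)
      also have "\<dots> = cmean (\<lambda>\<zeta>. poisson z \<zeta> * ln (norm (f \<zeta>)))"
      proof (rule cmean_cong)
        fix \<zeta> :: complex assume n: "norm \<zeta> = 1"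
        then have "\<zeta> \<noteq> a" using a1 by auto
        then show "real m * (poisson z \<zeta> * ln (norm (\<zeta> - a))) + poisson z \<zeta> * ln (norm (g \<zeta>)) =
          poisson z \<zeta> * ln (norm (f \<zeta>))"
          using gs[OF n] by (simp add: fg norm_mult norm_power ln_mult ln_realpow algebra_simps)
      qed
      finally show ?thesis .
    qed
  qed
qed

section \<open>The positive part of the logarithm and its circle means\<close>

definition ln_pos :: "real \<Rightarrow> real" where
  "ln_pos x = ln (max 1 x)"

lemma ln_pos_nonneg: "0 \<le> ln_pos x"
  by (simp add: ln_pos_def)

lemma ln_le_ln_pos: "0 \<le> x \<Longrightarrow> ln x \<le> ln_pos x"
  by (cases "x = 0") (auto simp: ln_pos_def)

lemma ln_pos_mono: "x \<le> y \<Longrightarrow> ln_pos x \<le> ln_pos y"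
  by (auto simp: ln_pos_def)

lemma ln_eq_ln_pos_diff: "0 < x \<Longrightarrow> ln x = ln_pos x - ln_pos (1 / x)"
  by (auto simp: ln_pos_def max_def ln_div)

lemma ln_pos_mult_le:
  assumes "0 \<le> x" "0 \<le> y" shows "ln_pos (x * y) \<le> ln_pos x + ln_pos y"
proof -
  have "1 * 1 \<le> max 1 x * max 1 y" by (intro mult_mono) auto
  moreover have "x * y \<le> max 1 x * max 1 y" using assms by (intro mult_mono) auto
  ultimately have "ln (max 1 (x * y)) \<le> ln (max 1 x * max 1 y)"
    by (subst ln_le_cancel_iff) auto
  also have "\<dots> = ln_pos x + ln_pos y" unfolding ln_pos_def by (subst ln_mult) auto
  finally show ?thesis by (simp add: ln_pos_def)
qed

text \<open>Turns half-power means, which Kolmogorov's inequality controls, into logarithmic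
  means.\<close>

lemma ln_pos_le_sqrt:
  assumes "0 \<le> x" shows "ln_pos x \<le> 2 * sqrt x"
proof (cases "x \<le> 1")
  case False
  then have "ln x = 2 * ln (sqrt x)" by (simp add: ln_sqrt)
  also have "ln (sqrt x) \<le> sqrt x" using False by (intro ln_bound) auto
  finally show ?thesis using False by (simp add: ln_pos_def max_def)
qed (use assms in \<open>simp add: ln_pos_def max_def\<close>)

lemma continuous_on_ln_pos [continuous_intros]:
  "continuous_on S f \<Longrightarrow> continuous_on S (\<lambda>x. ln_pos (f x))"
  unfolding ln_pos_def by (intro continuous_intros) auto

text \<open>Poisson--Jensen with the negative part of the logarithm discarded; 3 bounds the kernel
  on the half disc.\<close>

lemma ln_pos_norm_le_cmean:
  assumes hol: "f holomorphic_on UNIV" and nz: "\<And>w. norm w = 1 \<Longrightarrow> f w \<noteq> 0" and z: "norm z \<le> 1/2"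
  shows "ln_pos (norm (f z)) \<le> 3 * cmean (\<lambda>\<zeta>. ln_pos (norm (f \<zeta>)))"
proof -
  have cf: "continuous_on (sphere 0 1) f"
    using continuous_on_subset[OF holomorphic_on_imp_continuous_on[OF hol]] by auto
  have nn: "0 \<le> cmean (\<lambda>\<zeta>. ln_pos (norm (f \<zeta>)))"
    by (intro cmean_nonneg continuous_intros cf ln_pos_nonneg)
  show ?thesis
  proof (cases "norm (f z) \<le> 1")
    case True
    then show ?thesis using nn by (simp add: ln_pos_def)
  next
    case False
    then have "f z \<noteq> 0" by auto
    then have "ln (norm (f z)) \<le> cmean (\<lambda>\<zeta>. poisson z \<zeta> * ln (norm (f \<zeta>)))"
      using ln_norm_le_poisson[OF hol nz] z by auto
    also have "\<dots> \<le> cmean (\<lambda>\<zeta>. 3 * ln_pos (norm (f \<zeta>)))"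
    proof (rule cmean_mono)
      show "continuous_on (sphere 0 1) (\<lambda>\<zeta>. poisson z \<zeta> * ln (norm (f \<zeta>)))"
        using nz z by (intro continuous_intros continuous_on_poisson cf) auto
      show "continuous_on (sphere 0 1) (\<lambda>\<zeta>. 3 * ln_pos (norm (f \<zeta>)))"
        by (intro continuous_intros cf)
      fix \<zeta> :: complex assume n: "norm \<zeta> = 1"
      have "poisson z \<zeta> * ln (norm (f \<zeta>)) \<le> poisson z \<zeta> * ln_pos (norm (f \<zeta>))"
        using z by (intro mult_left_mono ln_le_ln_pos poisson_nonneg) auto
      also have "\<dots> \<le> 3 * ln_pos (norm (f \<zeta>))"
        by (intro mult_right_mono poisson_le z n ln_pos_nonneg)
      finally show "poisson z \<zeta> * ln (norm (f \<zeta>)) \<le> 3 * ln_pos (norm (f \<zeta>))" .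
    qed
    finally show ?thesis using False by (simp add: ln_pos_def cmean_cmul)
  qed
qed

text \<open>One nonzero value inside limits how small f can be on the circle in the mean. With M and
  N the means of log^+ |f| and log^+ (1 / |f|), the kernel bounds give ln |f z| \<le> 3 M - N / 3;
  solving for N produces 9 and 3.\<close>

lemma cmean_ln_pos_inverse_le:
  assumes hol: "f holomorphic_on UNIV" and nz: "\<And>w. norm w = 1 \<Longrightarrow> f w \<noteq> 0"
    and z: "norm z \<le> 1/2" "f z \<noteq> 0"
  shows "cmean (\<lambda>\<zeta>. ln_pos (1 / norm (f \<zeta>))) \<le> 9 * cmean (\<lambda>\<zeta>. ln_pos (norm (f \<zeta>))) - 3 * ln (norm (f z))"
proof -
  have cf: "continuous_on (sphere 0 1) f"
    using continuous_on_subset[OF holomorphic_on_imp_continuous_on[OF hol]] by auto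
  have c1: "continuous_on (sphere 0 1) (\<lambda>\<zeta>. ln_pos (norm (f \<zeta>)))"
    by (intro continuous_intros cf)
  have c2: "continuous_on (sphere 0 1) (\<lambda>\<zeta>. ln_pos (1 / norm (f \<zeta>)))"
    using nz by (intro continuous_intros cf) auto
  have "ln (norm (f z)) \<le> cmean (\<lambda>\<zeta>. poisson z \<zeta> * ln (norm (f \<zeta>)))"
    using ln_norm_le_poisson[OF hol nz] z by auto
  also have "\<dots> \<le> cmean (\<lambda>\<zeta>. 3 * ln_pos (norm (f \<zeta>)) - 1/3 * ln_pos (1 / norm (f \<zeta>)))"
  proof (rule cmean_mono)
    show "continuous_on (sphere 0 1) (\<lambda>\<zeta>. poisson z \<zeta> * ln (norm (f \<zeta>)))"
      using nz z by (intro continuous_intros continuous_on_poisson cf) auto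
    show "continuous_on (sphere 0 1) (\<lambda>\<zeta>. 3 * ln_pos (norm (f \<zeta>)) - 1/3 * ln_pos (1 / norm (f \<zeta>)))"
      by (intro continuous_intros c1 c2)
    fix \<zeta> :: complex assume n: "norm \<zeta> = 1"
    have "poisson z \<zeta> * ln (norm (f \<zeta>)) = poisson z \<zeta> * ln_pos (norm (f \<zeta>)) - poisson z \<zeta> * ln_pos (1 / norm (f \<zeta>))"
      using nz[OF n] by (subst ln_eq_ln_pos_diff) (auto simp: algebra_simps)
    also have "\<dots> \<le> 3 * ln_pos (norm (f \<zeta>)) - 1/3 * ln_pos (1 / norm (f \<zeta>))"
      by (intro diff_mono mult_right_mono poisson_le poisson_ge z n ln_pos_nonneg)
    finally show "poisson z \<zeta> * ln (norm (f \<zeta>)) \<le> 3 * ln_pos (norm (f \<zeta>)) - 1/3 * ln_pos (1 / norm (f \<zeta>))" .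
  qed
  also have "\<dots> = 3 * cmean (\<lambda>\<zeta>. ln_pos (norm (f \<zeta>))) - 1/3 * cmean (\<lambda>\<zeta>. ln_pos (1 / norm (f \<zeta>)))"
    unfolding cmean_cmul[symmetric] by (intro cmean_diff continuous_intros c1 c2)
  finally show ?thesis by simp
qed

section \<open>Kolmogorov's inequality\<close>

lemma sqrt_norm_add_le: "sqrt (norm (x + y)) \<le> sqrt (norm x) + sqrt (norm y)"
  by (rule order_trans[OF _ sqrt_add_le_add_sqrt]) (auto intro: norm_triangle_ineq)

text \<open>As |s \<zeta>| < 1, \<open>1 - s * \<zeta>\<close> lies in the right half-plane, which
  inversion maps to itself. Positive combinations of the inverses therefore avoid the branch cut of
  \<open>csqrt\<close>.\<close>

lemma one_minus_mult_nonzero: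
  fixes s \<zeta> :: complex
  assumes "norm s < 1" "norm \<zeta> \<le> 1" shows "1 - s * \<zeta> \<noteq> 0" "Re (1 / (1 - s * \<zeta>)) > 0"
proof -
  have "norm s * norm \<zeta> \<le> norm s * 1" using assms by (intro mult_left_mono) auto
  then have n: "norm (s * \<zeta>) < 1" using assms by (simp add: norm_mult)
  then show nz: "1 - s * \<zeta> \<noteq> 0" by auto
  have "Re (s * \<zeta>) < 1" using n complex_Re_le_cmod le_less_trans by blast
  then have r: "Re (1 - s * \<zeta>) > 0" by simp
  then have "Re (1 - s * \<zeta>) / ((Re (1 - s * \<zeta>))\<^sup>2 + (Im (1 - s * \<zeta>))\<^sup>2) > 0"
    by (intro divide_pos_pos add_pos_nonneg) auto
  then show "Re (1 / (1 - s * \<zeta>)) > 0" by (subst Re_divide) simp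
qed

text \<open>For nonnegative weights the sum has positive real part, so its principal square root is
  holomorphic and has real part at least \<open>1 / sqrt 2\<close> times its modulus; the mean value property applies.\<close>

lemma cmean_sqrt_cauchy_pos:
  fixes p :: "'i \<Rightarrow> real" and s :: "'i \<Rightarrow> complex"
  assumes fin: "finite I" and p: "\<And>i. i \<in> I \<Longrightarrow> 0 \<le> p i" and s: "\<And>i. i \<in> I \<Longrightarrow> norm (s i) < 1"
  shows "cmean (\<lambda>\<zeta>. sqrt (norm (\<Sum>i\<in>I. of_real (p i) / (1 - s i * \<zeta>)))) \<le> 3/2 * sqrt (\<Sum>i\<in>I. p i)"
proof (cases "\<forall>i\<in>I. p i = 0")
  case True
  then show ?thesis by (simp add: cmean_const)
next
  case False
  define k where "k = (\<lambda>\<zeta>. \<Sum>i\<in>I. of_real (p i) / (1 - s i * \<zeta>))"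
  have hk: "k holomorphic_on cball 0 1"
    unfolding k_def using one_minus_mult_nonzero s by (intro holomorphic_intros) auto
  have Re_k: "Re (k \<zeta>) > 0" if "norm \<zeta> \<le> 1" for \<zeta>
  proof -
    have e: "Re (of_real (p i) / (1 - s i * \<zeta>)) = p i * Re (1 / (1 - s i * \<zeta>))" for i
      by (simp add: Re_divide)
    have pos: "Re (1 / (1 - s i * \<zeta>)) > 0" if "i \<in> I" for i
      using one_minus_mult_nonzero(2)[OF s[OF that] \<open>norm \<zeta> \<le> 1\<close>] .
    obtain j where "j \<in> I" "p j > 0" using False p by force
    then show ?thesis unfolding k_def Re_sum e
      using fin p pos by (intro sum_pos2[of _ j]) (auto intro!: mult_nonneg_nonneg less_imp_le[OF pos])
  qed
  then have "k \<zeta> \<notin> \<real>\<^sub>\<le>\<^sub>0" if "norm \<zeta> \<le> 1" for \<zeta>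
    using that by (force simp: complex_nonpos_Reals_iff)
  then have hs: "(\<lambda>\<zeta>. csqrt (k \<zeta>)) holomorphic_on cball 0 1"
    by (intro holomorphic_on_csqrt' hk) auto
  then have cs: "continuous_on (cball 0 1) (\<lambda>\<zeta>. csqrt (k \<zeta>))"
    by (rule holomorphic_on_imp_continuous_on)
  have ck: "continuous_on (sphere 0 1) k"
    by (rule continuous_on_subset[OF holomorphic_on_imp_continuous_on[OF hk]]) auto
  have "cmean (\<lambda>\<zeta>. sqrt (norm (k \<zeta>))) \<le> cmean (\<lambda>\<zeta>. 3/2 * Re (csqrt (k \<zeta>)))"
  proof (rule cmean_mono)
    show "continuous_on (sphere 0 1) (\<lambda>\<zeta>. sqrt (norm (k \<zeta>)))" by (intro continuous_intros ck)
    show "continuous_on (sphere 0 1) (\<lambda>\<zeta>. 3/2 * Re (csqrt (k \<zeta>)))"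
      by (intro continuous_intros continuous_on_subset[OF cs]) auto
    fix \<zeta> :: complex assume n: "norm \<zeta> = 1"
    \<comment> \<open>The square of \<open>Re (csqrt w)\<close> is (|w| + Re w) / 2, which is at
      least |w| / 2 when Re w > 0. The factor 3/2 is a rational upper bound for sqrt 2.\<close>
    have "sqrt (norm (k \<zeta>)) \<le> sqrt ((3/2)\<^sup>2 * ((norm (k \<zeta>) + Re (k \<zeta>)) / 2))"
      using Re_k[of \<zeta>] n by (simp add: power2_eq_square)
    also have "\<dots> = 3/2 * Re (csqrt (k \<zeta>))" unfolding real_sqrt_mult by simp
    finally show "sqrt (norm (k \<zeta>)) \<le> 3/2 * Re (csqrt (k \<zeta>))" .
  qed
  also have "\<dots> = 3/2 * Re (csqrt (k 0))"
    unfolding cmean_cmul using cs holomorphic_on_subset[OF hs ball_subset_cball]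
    by (subst mean_value_Re) auto
  also have "k 0 = of_real (\<Sum>i\<in>I. p i)" by (simp add: k_def)
  also have "Re (csqrt (of_real (\<Sum>i\<in>I. p i))) = sqrt (\<Sum>i\<in>I. p i)"
    using p by (subst csqrt_of_real_nonneg) (auto intro: sum_nonneg)
  finally show ?thesis by (simp add: k_def)
qed

text \<open>Complex weights split into the positive and negative parts of their real and imaginary
  parts; the square root is subadditive, so four positive cases give 4 * 3/2 = 6.\<close>

lemma cmean_sqrt_cauchy:
  fixes q s :: "'i \<Rightarrow> complex"
  assumes fin: "finite I" and s: "\<And>i. i \<in> I \<Longrightarrow> norm (s i) < 1"
  shows "cmean (\<lambda>\<zeta>. sqrt (norm (\<Sum>i\<in>I. q i / (1 - s i * \<zeta>)))) \<le> 6 * sqrt (\<Sum>i\<in>I. norm (q i))"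
proof -
  define S where "S = (\<lambda>p \<zeta>. \<Sum>i\<in>I. of_real (p i) / (1 - s i * \<zeta>))"
  have cS: "continuous_on (sphere 0 1) (\<lambda>\<zeta>. sqrt (norm (S p \<zeta>)))" for p
    unfolding S_def using one_minus_mult_nonzero s by (intro continuous_intros) auto
  have bS: "cmean (\<lambda>\<zeta>. sqrt (norm (S p \<zeta>))) \<le> 3/2 * sqrt (\<Sum>i\<in>I. norm (q i))"
    if "\<And>i. 0 \<le> p i" "\<And>i. p i \<le> norm (q i)" for p
  proof -
    have "cmean (\<lambda>\<zeta>. sqrt (norm (S p \<zeta>))) \<le> 3/2 * sqrt (\<Sum>i\<in>I. p i)"
      unfolding S_def using that by (intro cmean_sqrt_cauchy_pos fin s)
    also have "\<dots> \<le> 3/2 * sqrt (\<Sum>i\<in>I. norm (q i))"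
      using that by (intro mult_left_mono real_sqrt_le_mono sum_mono) auto
    finally show ?thesis .
  qed
  let ?p1 = "\<lambda>i. max 0 (Re (q i))" and ?p2 = "\<lambda>i. max 0 (- Re (q i))"
  let ?p3 = "\<lambda>i. max 0 (Im (q i))" and ?p4 = "\<lambda>i. max 0 (- Im (q i))"
  have q: "q i = of_real (?p1 i) - of_real (?p2 i) + \<i> * of_real (?p3 i) - \<i> * of_real (?p4 i)" for i
    by (auto simp: complex_eq_iff max_def)
  have dec: "(\<Sum>i\<in>I. q i / (1 - s i * \<zeta>)) = S ?p1 \<zeta> + - S ?p2 \<zeta> + \<i> * S ?p3 \<zeta> + - (\<i> * S ?p4 \<zeta>)" for \<zeta>
    unfolding S_def sum_distrib_left sum_negf[symmetric] sum.distrib[symmetric]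
    by (intro sum.cong refl, subst q) (simp add: add_divide_distrib diff_divide_distrib)
  have "cmean (\<lambda>\<zeta>. sqrt (norm (\<Sum>i\<in>I. q i / (1 - s i * \<zeta>)))) \<le>
    cmean (\<lambda>\<zeta>. sqrt (norm (S ?p1 \<zeta>)) + sqrt (norm (S ?p2 \<zeta>)) + sqrt (norm (S ?p3 \<zeta>)) + sqrt (norm (S ?p4 \<zeta>)))"
  proof (rule cmean_mono)
    show "continuous_on (sphere 0 1) (\<lambda>\<zeta>. sqrt (norm (\<Sum>i\<in>I. q i / (1 - s i * \<zeta>))))"
      using one_minus_mult_nonzero s by (intro continuous_intros) auto
    show "continuous_on (sphere 0 1) (\<lambda>\<zeta>. sqrt (norm (S ?p1 \<zeta>)) + sqrt (norm (S ?p2 \<zeta>)) + sqrt (norm (S ?p3 \<zeta>)) + sqrt (norm (S ?p4 \<zeta>)))"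
      by (intro continuous_on_add cS)
    show "sqrt (norm (\<Sum>i\<in>I. q i / (1 - s i * \<zeta>))) \<le> sqrt (norm (S ?p1 \<zeta>)) + sqrt (norm (S ?p2 \<zeta>)) + sqrt (norm (S ?p3 \<zeta>)) + sqrt (norm (S ?p4 \<zeta>))" for \<zeta>
      unfolding dec
      by (rule order_trans[OF sqrt_norm_add_le] add_mono order_refl)+ (auto simp: norm_mult)
  qed
  also have "\<dots> = cmean (\<lambda>\<zeta>. sqrt (norm (S ?p1 \<zeta>))) + cmean (\<lambda>\<zeta>. sqrt (norm (S ?p2 \<zeta>)))
      + cmean (\<lambda>\<zeta>. sqrt (norm (S ?p3 \<zeta>))) + cmean (\<lambda>\<zeta>. sqrt (norm (S ?p4 \<zeta>)))"
    by (simp add: cmean_add cS continuous_on_add)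
  also have "\<dots> \<le> 3/2 * sqrt (\<Sum>i\<in>I. norm (q i)) + 3/2 * sqrt (\<Sum>i\<in>I. norm (q i))
      + 3/2 * sqrt (\<Sum>i\<in>I. norm (q i)) + 3/2 * sqrt (\<Sum>i\<in>I. norm (q i))"
    by (intro add_mono bS) (use abs_Re_le_cmod abs_Im_le_cmod in \<open>auto simp: abs_le_iff\<close>)
  finally show ?thesis by simp
qed

section \<open>Cauchy transforms on circles\<close>

text \<open>For \<open>y = norm (t n)\<close> the weight \<open>1 / max R y\<close> is the order of
  magnitude of 1 / |z - t n| on |z| = R when \<open>t n\<close> is not near the circle. Since
  \<open>max R y\<close> is at least the average of 1 and y, one summable weight dominates for all R
  \<ge> 1.\<close>

lemma cauchy_weights_bound:
  fixes R x y :: real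
  assumes "1 \<le> R" "0 \<le> y" "0 \<le> x"
  shows "x / max R y \<le> 2 * (x / (y + 1))"
proof -
  have "(y + 1) / 2 \<le> max R y" using assms by auto
  then have "x / max R y \<le> x / ((y + 1) / 2)" using assms by (intro divide_left_mono) auto
  then show ?thesis by (simp add: mult.commute)
qed

lemma cauchy_weights_summable:
  fixes b t :: "nat \<Rightarrow> complex"
  assumes "summable (\<lambda>n. norm (b n) / (norm (t n) + 1))" "1 \<le> R"
  shows "summable (\<lambda>n. norm (b n) / max R (norm (t n)))"
proof (rule summable_comparison_test)
  show "\<exists>N. \<forall>n\<ge>N. norm (norm (b n) / max R (norm (t n))) \<le> 2 * (norm (b n) / (norm (t n) + 1))"
    using cauchy_weights_bound assms by auto
  show "summable (\<lambda>n. 2 * (norm (b n) / (norm (t n) + 1)))"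
    by (intro summable_mult assms)
qed

text \<open>Dominated convergence for series: each term tends to 0, under a summable bound uniform
  in R \<ge> 1. This is where the smallness of the circle means comes from.\<close>

lemma cauchy_weights_tendsto_0:
  fixes b t :: "nat \<Rightarrow> complex"
  assumes "summable (\<lambda>n. norm (b n) / (norm (t n) + 1))"
  shows "((\<lambda>R. \<Sum>n. norm (b n) / max R (norm (t n))) \<longlongrightarrow> 0) at_top"
proof -
  have "((\<lambda>R. \<Sum>n. norm (b n) / max R (norm (t n))) \<longlongrightarrow> (\<Sum>n::nat. 0 :: real)) at_top"
  proof (rule tannerys_theorem[THEN conjunct2, THEN conjunct2])
    show "((\<lambda>R. norm (b n) / max R (norm (t n))) \<longlongrightarrow> 0) at_top" for n
    proof (rule tendsto_divide_0[OF tendsto_const])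
      show "filterlim (\<lambda>R. max R (norm (t n))) at_infinity at_top"
        by (rule filterlim_at_top_imp_at_infinity, rule filterlim_at_top_mono[OF filterlim_ident]) auto
    qed
    have "norm (norm (b n) / max R (norm (t n))) \<le> 2 * (norm (b n) / (norm (t n) + 1))" if "R \<ge> 1" for n R
      using cauchy_weights_bound[OF that, of "norm (t n)" "norm (b n)"] that by simp
    then show "\<forall>\<^sub>F (n, R) in sequentially \<times>\<^sub>F at_top.
        norm (norm (b n) / max R (norm (t n))) \<le> 2 * (norm (b n) / (norm (t n) + 1))"
      unfolding eventually_prod_filter
      by (intro exI[of _ "\<lambda>_. True"] exI[of _ "\<lambda>R. R \<ge> 1"] conjI)
         (auto simp: eventually_ge_at_top)
    show "summable (\<lambda>n. 2 * (norm (b n) / (norm (t n) + 1)))"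
      by (intro summable_mult assms)
  qed auto
  then show ?thesis by simp
qed

lemma finite_norm_le:
  assumes "filterlim (\<lambda>n::nat. norm (t n :: complex)) at_top sequentially"
  shows "finite {n. norm (t n) \<le> R}"
proof -
  have "\<forall>\<^sub>F n in sequentially. norm (t n) > R"
    using assms[unfolded filterlim_at_top_dense] by blast
  then obtain N where "\<And>n. n \<ge> N \<Longrightarrow> norm (t n) > R" unfolding eventually_sequentially by blast
  then have "{n. norm (t n) \<le> R} \<subseteq> {..<N}" by (force simp: not_less[symmetric])
  then show ?thesis by (rule finite_subset) simp
qed

lemma cauchy_far_term_le:
  fixes b t z :: complex
  assumes "R \<ge> 1" "norm z \<le> R" "norm t > 2 * R"
  shows "norm (b / (z - t)) \<le> 2 * (norm b / max R (norm t))"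
proof -
  have "norm t / 2 \<le> norm (z - t)"
    using norm_triangle_ineq2[of t z] assms by (simp add: norm_minus_commute)
  then have "norm (b / (z - t)) \<le> norm b / (norm t / 2)"
    unfolding norm_divide using assms by (intro divide_left_mono) (auto intro!: mult_pos_pos)
  then show ?thesis using assms by (simp add: max_def mult.commute)
qed

lemma cauchy_transform_summable:
  fixes b t :: "nat \<Rightarrow> complex"
  assumes lim: "filterlim (\<lambda>n. norm (t n)) at_top sequentially"
    and sum: "summable (\<lambda>n. norm (b n) / (norm (t n) + 1))"
  shows "summable (\<lambda>n. b n / (z - t n))"
proof (rule summable_comparison_test_ev)
  define R where "R = max 1 (norm z)"
  have R: "R \<ge> 1" "norm z \<le> R" by (auto simp: R_def)
  have "\<forall>\<^sub>F n in sequentially. norm (t n) > 2 * R"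
    using lim[unfolded filterlim_at_top_dense] by blast
  then show "\<forall>\<^sub>F n in sequentially. norm (b n / (z - t n)) \<le> 2 * (norm (b n) / max R (norm (t n)))"
    by eventually_elim (rule cauchy_far_term_le[OF R])
  show "summable (\<lambda>n. 2 * (norm (b n) / max R (norm (t n))))"
    by (intro summable_mult cauchy_weights_summable sum R)
qed

text \<open>Poles inside the circle and poles between R and 2 R form two finite groups; rescaled,
  each is a Cauchy sum with parameters in the unit disc and costs 6. The tail beyond 2 R is
  uniformly bounded and costs 2, in total 14. In both finite groups the weights are exactly |b n| /
  max R |t n|.\<close>

lemma cmean_sqrt_cauchy_transform:
  fixes b t :: "nat \<Rightarrow> complex"
  assumes lim: "filterlim (\<lambda>n. norm (t n)) at_top sequentially"
    and sum: "summable (\<lambda>n. norm (b n) / (norm (t n) + 1))"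
    and R: "R \<ge> 1" and tR: "\<And>n. norm (t n) \<noteq> R"
    and cont: "continuous_on (sphere 0 1) (\<lambda>\<zeta>. \<Sum>n. b n / (of_real R * \<zeta> - t n))"
  shows "cmean (\<lambda>\<zeta>. sqrt (norm (\<Sum>n. b n / (of_real R * \<zeta> - t n))))
    \<le> 14 * sqrt (\<Sum>n. norm (b n) / max R (norm (t n)))"
proof -
  define w where "w = (\<lambda>n. norm (b n) / max R (norm (t n)))"
  have sw: "summable w" unfolding w_def by (intro cauchy_weights_summable sum R)
  have w0: "0 \<le> w n" for n unfolding w_def using R by (intro divide_nonneg_nonneg) auto
  define I J where "I = {n. norm (t n) < R}" and "J = {n. R < norm (t n) \<and> norm (t n) \<le> 2 * R}"
  have fin: "finite I" "finite J"
    using finite_norm_le[OF lim, of R] finite_norm_le[OF lim, of "2 * R"]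
    by (auto simp: I_def J_def elim: rev_finite_subset)
  have disj: "I \<inter> J = {}" by (auto simp: I_def J_def)
  have far: "norm (t n) > 2 * R" if "n \<notin> I \<union> J" for n
    using that tR[of n] by (auto simp: I_def J_def)
  \<comment> \<open>The inner poles lie in the disc, so their sum is not holomorphic there. On the
    circle, however, its conjugate is \<open>\<zeta> * P \<zeta>\<close>, which has the modulus of
    \<open>P \<zeta>\<close>, and the poles of \<open>P\<close> are the reflected points
    outside.\<close>
  define P where "P = (\<lambda>\<zeta>. \<Sum>n\<in>I. (cnj (b n) / of_real R) / (1 - (cnj (t n) / of_real R) * \<zeta>))"
  define Q where "Q = (\<lambda>\<zeta>. \<Sum>n\<in>J. (- b n / t n) / (1 - (of_real R / t n) * \<zeta>))"
  have sI: "norm (cnj (t n) / of_real R) < 1" if "n \<in> I" for n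
    using that R by (auto simp: I_def norm_divide)
  have sJ: "norm (of_real R / t n) < 1" if "n \<in> J" for n
    using that R by (auto simp: J_def norm_divide divide_less_eq)
  have cP: "continuous_on (sphere 0 1) P"
    unfolding P_def using one_minus_mult_nonzero(1)[OF sI] by (intro continuous_intros) auto
  have cQ: "continuous_on (sphere 0 1) Q"
    unfolding Q_def using one_minus_mult_nonzero(1)[OF sJ] by (intro continuous_intros) auto
  have bound: "sqrt (norm (\<Sum>n. b n / (of_real R * \<zeta> - t n))) \<le>
      sqrt (norm (P \<zeta>)) + sqrt (norm (Q \<zeta>)) + 2 * sqrt (suminf w)" if \<zeta>: "norm \<zeta> = 1" for \<zeta>
  proof -
    let ?u = "\<lambda>n. b n / (of_real R * \<zeta> - t n)"
    have su: "summable ?u" by (rule cauchy_transform_summable[OF lim sum])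
    let ?v = "\<lambda>n. if n \<in> I \<union> J then ?u n else 0"
    have fv: "?v sums (\<Sum>n\<in>I \<union> J. ?u n)"
      by (rule sums_If_finite_set) (use fin in auto)
    have rest: "norm (?u n - ?v n) \<le> 2 * w n" for n
      using cauchy_far_term_le[OF R _ far[of n], of "of_real R * \<zeta>" "b n"] \<zeta> R w0[of n] by (auto simp: w_def norm_mult)
    have "suminf ?u = (\<Sum>n\<in>I \<union> J. ?u n) + (\<Sum>n. ?u n - ?v n)"
      using suminf_diff[OF su sums_summable[OF fv]] unfolding sums_unique[OF fv] by (simp add: algebra_simps)
    also have "(\<Sum>n\<in>I \<union> J. ?u n) = (\<Sum>n\<in>I. ?u n) + (\<Sum>n\<in>J. ?u n)"
      by (rule sum.union_disjoint) (use fin disj in auto)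
    finally have eq: "suminf ?u = (\<Sum>n\<in>I. ?u n) + (\<Sum>n\<in>J. ?u n) + (\<Sum>n. ?u n - ?v n)" .
    have "sqrt (norm (suminf ?u)) \<le>
        sqrt (norm (\<Sum>n\<in>I. ?u n)) + sqrt (norm (\<Sum>n\<in>J. ?u n)) + sqrt (norm (\<Sum>n. ?u n - ?v n))"
      unfolding eq by (rule order_trans[OF sqrt_norm_add_le add_right_mono[OF sqrt_norm_add_le]])
    moreover have "norm (\<Sum>n\<in>I. ?u n) = norm (P \<zeta>)"
    proof -
      have cc: "\<zeta> * cnj \<zeta> = 1" using \<zeta> by (simp add: complex_norm_square[symmetric])
      have z0: "\<zeta> \<noteq> 0" using \<zeta> by auto
      have cz: "cnj \<zeta> = 1 / \<zeta>" using cc z0 by (simp add: field_simps)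
      have "cnj (?u n) = \<zeta> * ((cnj (b n) / of_real R) / (1 - (cnj (t n) / of_real R) * \<zeta>))" for n
      proof -
        have "of_real R * cnj \<zeta> - cnj (t n) = of_real R * (1 - (cnj (t n) / of_real R) * \<zeta>) / \<zeta>"
          unfolding cz using R z0 by (simp add: field_simps)
        then show ?thesis using R by simp
      qed
      then have "cnj (\<Sum>n\<in>I. ?u n) = \<zeta> * P \<zeta>"
        unfolding P_def cnj_sum sum_distrib_left by simp
      then have "norm (cnj (\<Sum>n\<in>I. ?u n)) = norm (\<zeta> * P \<zeta>)" by (rule arg_cong)
      then show ?thesis using \<zeta> by (simp only: complex_mod_cnj norm_mult mult_1)
    qed
    moreover have "(\<Sum>n\<in>J. ?u n) = Q \<zeta>"
      unfolding Q_def
    proof (intro sum.cong refl)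
      fix n assume "n \<in> J"
      then have "t n \<noteq> 0" using R by (auto simp: J_def)
      then have "of_real R * \<zeta> - t n = - t n * (1 - (of_real R / t n) * \<zeta>)" by (simp add: algebra_simps)
      then show "?u n = (- b n / t n) / (1 - (of_real R / t n) * \<zeta>)" by simp
    qed
    moreover have "sqrt (norm (\<Sum>n. ?u n - ?v n)) \<le> 2 * sqrt (suminf w)"
    proof -
      have "norm (\<Sum>n. ?u n - ?v n) \<le> (\<Sum>n. 2 * w n)"
        by (rule norm_suminf_le[OF rest]) (intro summable_mult sw)
      also have "\<dots> = 2 * suminf w" by (rule suminf_mult[OF sw])
      \<comment> \<open>Enlarging 2 to a perfect square gives a rational factor under the
        root.\<close>
      also have "\<dots> \<le> 2\<^sup>2 * suminf w" using suminf_nonneg[OF sw w0] by simp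
      finally have "sqrt (norm (\<Sum>n. ?u n - ?v n)) \<le> sqrt (2\<^sup>2 * suminf w)" by (rule real_sqrt_le_mono)
      then show ?thesis unfolding real_sqrt_mult by simp
    qed
    ultimately show ?thesis by simp
  qed
  have sumle: "(\<Sum>n\<in>K. w n) \<le> suminf w" if "finite K" for K
    using sum_le_suminf[OF sw that] w0 by simp
  have P: "cmean (\<lambda>\<zeta>. sqrt (norm (P \<zeta>))) \<le> 6 * sqrt (suminf w)"
  proof -
    have "cmean (\<lambda>\<zeta>. sqrt (norm (P \<zeta>))) \<le> 6 * sqrt (\<Sum>n\<in>I. norm (cnj (b n) / of_real R))"
      unfolding P_def by (rule cmean_sqrt_cauchy[OF fin(1) sI])
    also have "(\<Sum>n\<in>I. norm (cnj (b n) / of_real R)) = (\<Sum>n\<in>I. w n)"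
      using R by (intro sum.cong) (auto simp: I_def w_def norm_divide max_def)
    also have "6 * sqrt \<dots> \<le> 6 * sqrt (suminf w)"
      by (intro mult_left_mono real_sqrt_le_mono sumle fin) auto
    finally show ?thesis .
  qed
  have Q: "cmean (\<lambda>\<zeta>. sqrt (norm (Q \<zeta>))) \<le> 6 * sqrt (suminf w)"
  proof -
    have "cmean (\<lambda>\<zeta>. sqrt (norm (Q \<zeta>))) \<le> 6 * sqrt (\<Sum>n\<in>J. norm (- b n / t n))"
      unfolding Q_def by (rule cmean_sqrt_cauchy[OF fin(2) sJ])
    also have "(\<Sum>n\<in>J. norm (- b n / t n)) = (\<Sum>n\<in>J. w n)"
      using R by (intro sum.cong) (auto simp: J_def w_def norm_divide max_def)
    also have "6 * sqrt \<dots> \<le> 6 * sqrt (suminf w)"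
      by (intro mult_left_mono real_sqrt_le_mono sumle fin) auto
    finally show ?thesis .
  qed
  have "cmean (\<lambda>\<zeta>. sqrt (norm (\<Sum>n. b n / (of_real R * \<zeta> - t n)))) \<le>
    cmean (\<lambda>\<zeta>. sqrt (norm (P \<zeta>)) + sqrt (norm (Q \<zeta>)) + 2 * sqrt (suminf w))"
    by (intro cmean_mono bound continuous_intros cont cP cQ)
  also have "\<dots> = cmean (\<lambda>\<zeta>. sqrt (norm (P \<zeta>))) + cmean (\<lambda>\<zeta>. sqrt (norm (Q \<zeta>))) + 2 * sqrt (suminf w)"
    using cP cQ by (simp add: cmean_add cmean_const continuous_intros)
  also have "\<dots> \<le> 14 * sqrt (suminf w)" using P Q by simp
  finally show ?thesis by (simp add: w_def)
qed

section \<open>Quotients of entire functions and growth\<close>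

text \<open>The multiplicity is expressed by iterated derivatives, as in the vanishing hypothesis of
  the theorem. The order n = 0 is included, with \<open>g = f\<close> near z by continuity, so
  points off the zero set fit the same pattern.\<close>

lemma entire_first_nonzero_deriv:
  assumes holf: "f holomorphic_on UNIV" and ne: "f b \<noteq> 0"
  obtains n g r where "\<And>j. j < n \<Longrightarrow> (deriv ^^ j) f z = 0" "(deriv ^^ n) f z \<noteq> 0"
    "0 < r" "g holomorphic_on ball z r" "\<And>w. w \<in> ball z r \<Longrightarrow> f w = (w - z) ^ n * g w"
    "\<And>w. w \<in> ball z r \<Longrightarrow> g w \<noteq> 0"
proof -
  have "\<exists>n. (deriv ^^ n) f z \<noteq> 0"
    using holomorphic_fun_eq_0_on_connected[OF holf open_UNIV connected_UNIV, of z b] ne by auto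
  then obtain n where n: "(deriv ^^ n) f z \<noteq> 0" and min: "\<And>j. j < n \<Longrightarrow> (deriv ^^ j) f z = 0"
    using exists_least_iff[of "\<lambda>n. (deriv ^^ n) f z \<noteq> 0"] by blast
  show ?thesis
  proof (cases "n = 0")
    case True
    have "open (f -` (- {0}))"
      using holomorphic_on_imp_continuous_on[OF holf] by (intro open_vimage) auto
    moreover have "z \<in> f -` (- {0})" using n True by auto
    ultimately obtain r where "0 < r" "ball z r \<subseteq> f -` (- {0})" by (meson openE)
    moreover from this have "f w \<noteq> 0" if "w \<in> ball z r" for w using that by auto
    moreover have "f holomorphic_on ball z r" using holomorphic_on_subset[OF holf] by simp
    ultimately show ?thesis using that[of n r f] n min True by simp
  next
    case False
    then have "f z = 0" using min[of 0] by simp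
    obtain g r where "0 < r" "g holomorphic_on ball z r"
       "\<And>w. w \<in> ball z r \<Longrightarrow> f w - f z = (w - z)^n * g w" "\<And>w. w \<in> ball z r \<Longrightarrow> g w \<noteq> 0"
      using holomorphic_factor_order_of_zero[OF holf open_UNIV UNIV_I _ n] min False
      by (metis bot_nat_0.not_eq_extremum)
    then show ?thesis using that[of n r g] n min \<open>f z = 0\<close> by auto
  qed
qed

text \<open>\<open>vanish\<close> forces the order of F at each point to be at least that of G, so F
  / G has only removable singularities. The case F = 0 is split off because no finite order exists
  for it.\<close>

lemma entire_quotient:
  assumes holF: "F holomorphic_on UNIV" and holG: "G holomorphic_on UNIV" and ne: "G b \<noteq> 0"
    and vanish: "\<And>z k. (\<forall>j\<le>k. (deriv ^^ j) G z = 0) \<Longrightarrow> (deriv ^^ k) F z = 0"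
  obtains H where "H holomorphic_on UNIV" "\<And>z. F z = H z * G z"
proof (cases "\<exists>c. F c \<noteq> 0")
  case False
  then show ?thesis using that[of "\<lambda>_. 0"] by auto
next
  case True
  then obtain c where c: "F c \<noteq> 0" by blast
  define q where "q = (\<lambda>w. F w / G w)"
  have an: "remove_sings q analytic_on {z}" for z
  proof -
    obtain n g r where G: "\<And>j. j < n \<Longrightarrow> (deriv ^^ j) G z = 0"
      "0 < r" "g holomorphic_on ball z r" "\<And>w. w \<in> ball z r \<Longrightarrow> G w = (w - z) ^ n * g w"
      "\<And>w. w \<in> ball z r \<Longrightarrow> g w \<noteq> 0"
      using entire_first_nonzero_deriv[OF holG ne] by metis
    obtain m f s where F: "(deriv ^^ m) F z \<noteq> 0"
      "0 < s" "f holomorphic_on ball z s" "\<And>w. w \<in> ball z s \<Longrightarrow> F w = (w - z) ^ m * f w"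
      using entire_first_nonzero_deriv[OF holF c] by metis
    have "n \<le> m"
    proof (rule ccontr)
      assume "\<not> n \<le> m"
      then show False using vanish[of m z] G(1) F(1) by auto
    qed
    define e where "e = min r s"
    have e: "e > 0" "ball z e \<subseteq> ball z r" "ball z e \<subseteq> ball z s" using G F by (auto simp: e_def)
    have iso: "isolated_singularity_at q z"
    proof (rule isolated_singularity_at_holomorphic)
      show "q holomorphic_on ball z e - {z}"
        unfolding q_def using e(2) G(4,5)
        by (intro holomorphic_intros holomorphic_on_subset[OF holF] holomorphic_on_subset[OF holG])
           (auto simp: subset_iff)
    qed (use e in auto)
    \<comment> \<open>Cancelling the common power of \<open>w - z\<close> leaves a function
      holomorphic near z, whose value at z is the limit of \<open>q\<close>.\<close>
    define p where "p = (\<lambda>w. (w - z) ^ (m - n) * f w / g w)"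
    have "p holomorphic_on ball z e"
      unfolding p_def using e G(5)
      by (intro holomorphic_intros holomorphic_on_subset[OF G(3)] holomorphic_on_subset[OF F(3)]) (auto simp: subset_iff)
    then have "isCont p z"
      using e(1) by (meson centre_in_ball continuous_on_eq_continuous_at holomorphic_on_imp_continuous_on open_ball)
    then have "p \<midarrow>z\<rightarrow> p z" by (simp add: isCont_def)
    moreover have "\<forall>\<^sub>F w in at z. p w = q w"
      unfolding eventually_at
    proof (intro exI[of _ e] conjI ballI impI)
      fix w assume w: "w \<noteq> z \<and> dist w z < e"
      then have "w \<in> ball z r" "w \<in> ball z s" using e by (auto simp: dist_commute subset_iff)
      then have "q w = (w - z) ^ m * f w / ((w - z) ^ n * g w)" unfolding q_def by (simp add: G(4) F(4))
      also have "(w - z) ^ m = (w - z) ^ n * (w - z) ^ (m - n)"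
        using \<open>n \<le> m\<close> by (simp flip: power_add)
      finally show "p w = q w" using w by (simp add: p_def)
    qed (rule e)
    ultimately have "q \<midarrow>z\<rightarrow> p z" by (rule Lim_transform_eventually)
    then show ?thesis by (rule remove_sings_analytic_at[OF iso])
  qed
  have "remove_sings q holomorphic_on UNIV"
    using an by (meson analytic_imp_holomorphic analytic_on_analytic_at)
  moreover have "F z = remove_sings q z * G z" for z
  proof (cases "G z = 0")
    case True
    then show ?thesis using vanish[of 0 z] by simp
  next
    case False
    have "q analytic_on {z}"
      unfolding q_def using False holF holG
      by (intro analytic_intros) (auto intro: holomorphic_on_imp_analytic_at)
    then show ?thesis using False by (simp add: q_def)
  qed
  ultimately show ?thesis using that by blast
qed

text \<open>Finite order in terms of log^+: the bound holds on the whole plane, without a threshold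
  radius, and the exponent is a natural number, so a fourfold radius costs at most the factor
  4^m.\<close>

definition poly_log_growth :: "(complex \<Rightarrow> complex) \<Rightarrow> bool" where
  "poly_log_growth f \<longleftrightarrow> (\<exists>C m. \<forall>z. ln_pos (norm (f z)) \<le> C * (1 + norm z) ^ m)"

lemma finite_order_imp_poly_log_growth:
  assumes "entire_finite_order f"
  shows "poly_log_growth f"
proof -
  obtain \<rho> R :: real where holf: "f holomorphic_on UNIV"
    and R: "\<And>z. norm z \<ge> R \<Longrightarrow> norm (f z) \<le> exp (norm z powr \<rho>)"
    using assms unfolding entire_finite_order_def by blast
  \<comment> \<open>The order is rounded up; a negative \<rho> gives 0. The exceptional disc has
    radius at least 1, so that beyond it a power with negative exponent is at most 1.\<close>
  define m where "m = nat \<lceil>\<rho>\<rceil>"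
  have "continuous_on (cball 0 (max 1 R)) (\<lambda>z. ln_pos (norm (f z)))"
    by (intro continuous_intros continuous_on_subset[OF holomorphic_on_imp_continuous_on[OF holf]]) auto
  then have "bdd_above ((\<lambda>z. ln_pos (norm (f z))) ` cball 0 (max 1 R))"
    by (intro bounded_imp_bdd_above compact_imp_bounded compact_continuous_image) auto
  then obtain B where "\<forall>y\<in>(\<lambda>z. ln_pos (norm (f z))) ` cball 0 (max 1 R). y \<le> B"
    unfolding bdd_above_def by blast
  then have B: "ln_pos (norm (f z)) \<le> B" if "norm z \<le> max 1 R" for z
    using that by (simp del: max.bounded_iff le_max_iff_disj)
  have "ln_pos (norm (f z)) \<le> max 1 B * (1 + norm z) ^ m" for z
  proof (cases "norm z \<le> max 1 R")
    case True
    have "ln_pos (norm (f z)) \<le> max 1 B * 1" using B[OF True] by simp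
    also have "\<dots> \<le> max 1 B * (1 + norm z) ^ m" by (intro mult_left_mono one_le_power) auto
    finally show ?thesis .
  next
    case far: False
    have pr: "(1 + norm z) powr real m = (1 + norm z) ^ m"
      by (intro powr_realpow add_pos_nonneg) auto
    have "ln_pos (norm (f z)) \<le> ln_pos (exp (norm z powr \<rho>))"
      using far by (intro ln_pos_mono R) auto
    also have "\<dots> = norm z powr \<rho>" by (simp add: ln_pos_def max_def)
    also have "\<dots> \<le> (1 + norm z) powr (real m)"
    proof (cases "\<rho> \<ge> 0")
      case True
      then have "norm z powr \<rho> \<le> (1 + norm z) powr \<rho>" by (intro powr_mono2) auto
      also have "\<dots> \<le> (1 + norm z) powr (real m)"
        unfolding m_def by (intro powr_mono) (linarith, simp)
      finally show ?thesis .
    next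
      case False
      then have "norm z powr \<rho> \<le> norm z powr 0"
        using far by (intro powr_mono) auto
      also have "\<dots> \<le> (1 + norm z) ^ m" 
      proof -
        have "norm z powr 0 \<le> 1" by simp
        also have "\<dots> \<le> (1 + norm z) ^ m" by (rule one_le_power) simp
        finally show ?thesis .
      qed
      finally show ?thesis by (simp add: pr)
    qed
    also have "\<dots> = 1 * (1 + norm z) ^ m" by (simp add: pr)
    also have "\<dots> \<le> max 1 B * (1 + norm z) ^ m" by (intro mult_right_mono) auto
    finally show ?thesis .
  qed
  then show ?thesis unfolding poly_log_growth_def by blast
qed

text \<open>Serves to pass the growth bound from A(z) / (z - w), with w a zero of A, to A itself;
  the linear factor costs one degree.\<close>

lemma poly_log_growth_mult_linear:
  assumes "poly_log_growth f" and "\<And>z. norm (g z) \<le> norm (z - w) * norm (f z)"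
  shows "poly_log_growth g"
proof -
  obtain C m where C: "\<And>z. ln_pos (norm (f z)) \<le> C * (1 + norm z) ^ m"
    using assms(1) unfolding poly_log_growth_def by blast
  have C0: "C \<ge> 0" using C[of 0] ln_pos_nonneg[of "norm (f 0)"] by simp
  have "ln_pos (norm (g z)) \<le> (1 + norm w + C) * (1 + norm z) ^ Suc m" for z
  proof -
    have "ln_pos (norm (g z)) \<le> ln_pos (norm (z - w) * norm (f z))" by (intro ln_pos_mono assms)
    also have "\<dots> \<le> ln_pos (norm (z - w)) + ln_pos (norm (f z))" by (intro ln_pos_mult_le) auto
    also have "ln_pos (norm (z - w)) \<le> max 1 (norm (z - w))"
      unfolding ln_pos_def by (intro ln_bound) auto
    also have "\<dots> \<le> (1 + norm w) * (1 + norm z)"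
      using norm_triangle_ineq4[of z w] mult_nonneg_nonneg[of "norm w" "norm z"] norm_ge_zero[of w] norm_ge_zero[of z]
      unfolding max.bounded_iff distrib_left distrib_right by linarith
    also have "\<dots> \<le> (1 + norm w) * (1 + norm z) ^ Suc m"
      using power_increasing[of 1 "Suc m" "1 + norm z"] by (intro mult_left_mono) auto
    also have "ln_pos (norm (f z)) \<le> C * (1 + norm z) ^ Suc m"
      using C[of z] mult_left_mono[OF power_increasing[of m "Suc m" "1 + norm z"] C0] by simp
    finally show ?thesis by (simp add: algebra_simps)
  qed
  then show ?thesis unfolding poly_log_growth_def by blast
qed

text \<open>\<open>B\<close> ranges over all bounds on the disc of radius 4 r, which replaces the
  maximum u(4 r) without forming a supremum. After k steps the bound is \<epsilon>^k C (1 + 4^k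
  r)^m, and 1 + 4^k r \<le> 4^k (1 + r).\<close>

lemma poly_log_growth_contraction:
  assumes "poly_log_growth h"
    and contr: "\<And>\<epsilon>. \<epsilon> > 0 \<Longrightarrow> \<exists>r0\<ge>1. \<forall>r\<ge>r0. \<forall>B. (\<forall>w. norm w \<le> 4 * r \<longrightarrow> ln_pos (norm (h w)) \<le> B) \<longrightarrow>
        (\<forall>z. norm z \<le> r \<longrightarrow> ln_pos (norm (h z)) \<le> \<epsilon> * B)"
  shows "norm (h z) \<le> 1"
proof -
  obtain C m where C: "\<And>z. ln_pos (norm (h z)) \<le> C * (1 + norm z) ^ m"
    using assms(1) unfolding poly_log_growth_def by blast
  have C0: "C \<ge> 0" using C[of 0] ln_pos_nonneg[of "norm (h 0)"] by simp
  \<comment> \<open>Makes \<epsilon> * 4^m = 1/2: every iteration halves the bound in spite of the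
    growth.\<close>
  define \<epsilon> :: real where "\<epsilon> = 1 / (2 * 4 ^ m)"
  have \<epsilon>: "\<epsilon> > 0" by (simp add: \<epsilon>_def)
  obtain r0 where r0: "r0 \<ge> 1" and r0': "\<And>r B z. r \<ge> r0 \<Longrightarrow> (\<And>w. norm w \<le> 4 * r \<Longrightarrow> ln_pos (norm (h w)) \<le> B) \<Longrightarrow>
        norm z \<le> r \<Longrightarrow> ln_pos (norm (h z)) \<le> \<epsilon> * B"
    using contr[OF \<epsilon>] by metis
  have it: "ln_pos (norm (h z)) \<le> \<epsilon> ^ k * (C * (1 + 4 ^ k * r) ^ m)" if "r \<ge> r0" "norm z \<le> r" for k r z
    using that
  proof (induction k arbitrary: r z)
    case 0
    have "C * (1 + norm z) ^ m \<le> C * (1 + r) ^ m" using 0 C0 by (intro mult_left_mono power_mono) auto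
    then show ?case using C[of z] by simp
  next
    case (Suc k)
    have "ln_pos (norm (h z)) \<le> \<epsilon> * (\<epsilon> ^ k * (C * (1 + 4 ^ k * (4 * r)) ^ m))"
      by (rule r0'[OF Suc.prems(1) Suc.IH Suc.prems(2)]) (use r0 Suc.prems in auto)
    then show ?case by (simp add: mult_ac)
  qed
  define r where "r = max r0 (norm z)"
  have r: "r \<ge> r0" "norm z \<le> r" "r \<ge> 1" using r0 by (auto simp: r_def)
  have le: "ln_pos (norm (h z)) \<le> (1/2) ^ k * (C * (1 + r) ^ m)" for k
  proof -
    have "1 + 4 ^ k * r \<le> 4 ^ k * (1 + r)" by (simp add: algebra_simps)
    then have "C * (1 + 4 ^ k * r) ^ m \<le> C * (4 ^ k * (1 + r)) ^ m"
      using C0 r by (intro mult_left_mono power_mono) auto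
    then have "\<epsilon> ^ k * (C * (1 + 4 ^ k * r) ^ m) \<le> \<epsilon> ^ k * (C * (4 ^ k * (1 + r)) ^ m)"
      by (rule mult_left_mono) (use \<epsilon> in auto)
    also have "\<dots> = (\<epsilon> * 4 ^ m) ^ k * (C * (1 + r) ^ m)"
      by (simp add: power_mult_distrib mult_ac flip: power_mult)
    also have "\<epsilon> * 4 ^ m = 1/2" by (simp add: \<epsilon>_def)
    finally show ?thesis using it[OF r(1,2), of k] by simp
  qed
  have "(\<lambda>k. (1/2) ^ k * (C * (1 + r) ^ m)) \<longlonglongrightarrow> 0"
    by (intro tendsto_mult_left_zero LIMSEQ_power_zero) auto
  then have "ln_pos (norm (h z)) \<le> 0"
    by (rule tendsto_lowerbound) (use le in auto)
  then show ?thesis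
    using ln_gt_zero[of "norm (h z)"] unfolding ln_pos_def
    by (cases "1 < norm (h z)") (auto simp: max_def split: if_splits)
qed

section \<open>The uniqueness theorem\<close>

locale cauchy_de_branges =
  fixes t :: "nat \<Rightarrow> complex" and A :: "complex \<Rightarrow> complex"
  assumes t_inf: "filterlim (\<lambda>n. norm (t n)) at_top sequentially"
    and A_entire: "A holomorphic_on UNIV"
    and A_zeros: "{z. A z = 0} = range t"
begin

lemma A_eq_0_iff: "A z = 0 \<longleftrightarrow> z \<in> range t"
  using A_zeros by blast

text \<open>On a circle without zeros of A the series equals F / A - \<kappa>, which yields
  continuity with no discussion of uniform convergence. The constant \<kappa> lets one statement
  serve F (\<kappa> = 0), G (\<kappa> = \<gamma>) and the zero function.\<close>

lemma circle_sum:
  assumes F: "F holomorphic_on UNIV"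
    and F_eq: "\<And>z. z \<notin> range t \<Longrightarrow> F z = A z * (\<kappa> + (\<Sum>n. b n / (z - t n)))"
    and R: "R \<ge> 1" "\<And>z. norm z = R \<Longrightarrow> A z \<noteq> 0"
    and sum: "summable (\<lambda>n. norm (b n) / (norm (t n) + 1))"
  shows "continuous_on (sphere 0 1) (\<lambda>\<zeta>. \<Sum>n. b n / (of_real R * \<zeta> - t n))"
    and "cmean (\<lambda>\<zeta>. sqrt (norm (\<Sum>n. b n / (of_real R * \<zeta> - t n))))
      \<le> 14 * sqrt (\<Sum>n. norm (b n) / max R (norm (t n)))"
proof -
  have nzA: "A (of_real R * \<zeta>) \<noteq> 0" if "norm \<zeta> = 1" for \<zeta>
    using R that by (simp add: norm_mult)
  have eq: "(\<Sum>n. b n / (of_real R * \<zeta> - t n)) = F (of_real R * \<zeta>) / A (of_real R * \<zeta>) - \<kappa>"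
    if "norm \<zeta> = 1" for \<zeta>
    using F_eq[of "of_real R * \<zeta>"] nzA[OF that] A_eq_0_iff[of "of_real R * \<zeta>"] by simp
  have "continuous_on (sphere 0 1) (\<lambda>\<zeta>. F (of_real R * \<zeta>) / A (of_real R * \<zeta>) - \<kappa>)"
    using nzA by (intro continuous_intros continuous_on_compose2[OF holomorphic_on_imp_continuous_on[OF F]]
        continuous_on_compose2[OF holomorphic_on_imp_continuous_on[OF A_entire]]) auto
  then show cont: "continuous_on (sphere 0 1) (\<lambda>\<zeta>. \<Sum>n. b n / (of_real R * \<zeta> - t n))"
    using eq by (subst continuous_on_cong[OF refl]) auto
  have "norm (t n) \<noteq> R" for n using R(2)[of "t n"] A_eq_0_iff[of "t n"] by auto
  then show "cmean (\<lambda>\<zeta>. sqrt (norm (\<Sum>n. b n / (of_real R * \<zeta> - t n))))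
      \<le> 14 * sqrt (\<Sum>n. norm (b n) / max R (norm (t n)))"
    by (intro cmean_sqrt_cauchy_transform t_inf sum R cont)
qed

end

text \<open>An entire function that is not identically zero has countably many zeros, hence
  countably many bad radii, while an open interval is uncountable. Three functions appear because
  the growth bound for the quotient must avoid the zeros of A, G and H together.\<close>

lemma exists_zero_free_radius:
  fixes f g h :: "complex \<Rightarrow> complex"
  assumes f: "f holomorphic_on UNIV" "f x \<noteq> 0" and g: "g holomorphic_on UNIV" "g y \<noteq> 0"
    and h: "h holomorphic_on UNIV" "h w \<noteq> 0" and ab: "a < (b::real)"
  obtains R where "a < R" "R < b" "\<And>z. norm z = R \<Longrightarrow> f z \<noteq> 0" "\<And>z. norm z = R \<Longrightarrow> g z \<noteq> 0"
    "\<And>z. norm z = R \<Longrightarrow> h z \<noteq> 0"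
proof -
  have cz: "countable {z. k z = 0}" if "k holomorphic_on UNIV" "k x \<noteq> 0" for k :: "complex \<Rightarrow> complex" and x
  proof (cases "k constant_on UNIV")
    case True
    then have "{z. k z = 0} = {}" using that(2) unfolding constant_on_def by auto
    then show ?thesis by simp
  next
    case False
    have "fsigma (UNIV :: complex set)" by (rule fsigma_UNIV)
    from holomorphic_countable_zeros[OF that(1) open_UNIV connected_UNIV this False] show ?thesis by simp
  qed
  define B where "B = norm ` ({z. f z = 0} \<union> {z. g z = 0} \<union> {z. h z = 0})"
  have "countable B" unfolding B_def using cz[OF f] cz[OF g] cz[OF h] by auto
  then have "\<not> {a<..<b} \<subseteq> B"
    using uncountable_open_interval[of a b] ab countable_subset by blast
  then obtain R where "R \<in> {a<..<b}" "R \<notin> B" by blast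
  then show ?thesis using that[of R] unfolding B_def by auto
qed

lemma sqrt_small_eventually:
  fixes D :: "real \<Rightarrow> real"
  assumes "(D \<longlongrightarrow> 0) at_top" "\<epsilon> > 0"
  shows "\<forall>\<^sub>F R in at_top. sqrt (D R) < \<epsilon>"
  using order_tendstoD(2)[OF tendsto_real_sqrt[OF assms(1)], of \<epsilon>] assms(2) by simp

section \<open>Growth of the quotient H\<close>

context cauchy_de_branges
begin

lemma quotient_growth_contraction:
  assumes F: "F holomorphic_on UNIV" and G: "G holomorphic_on UNIV" and H: "H holomorphic_on UNIV"
    and F_eq: "\<And>z. z \<notin> range t \<Longrightarrow> F z = A z * (\<Sum>n. b n / (z - t n))"
    and G_eq: "\<And>z. z \<notin> range t \<Longrightarrow> G z = A z * (\<gamma> + (\<Sum>n. a n / (z - t n)))"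
    and FHG: "\<And>z. F z = H z * G z" and \<gamma>: "\<gamma> \<noteq> 0" and H_nz: "H x \<noteq> 0"
    and b_sum: "summable (\<lambda>n. norm (b n) / (norm (t n) + 1))"
    and a_sum: "summable (\<lambda>n. norm (a n) / (norm (t n) + 1))"
    and \<epsilon>: "\<epsilon> > 0" and A_nz: "A y \<noteq> 0"
  shows "\<exists>r0\<ge>1. \<forall>r\<ge>r0. \<forall>B. (\<forall>w. norm w \<le> 4 * r \<longrightarrow> ln_pos (norm (H w)) \<le> B) \<longrightarrow>
        (\<forall>z. norm z \<le> r \<longrightarrow> ln_pos (norm (H z)) \<le> \<epsilon> * B)"
proof -
  define D where "D = (\<lambda>b R. \<Sum>n. norm (b n :: complex) / max R (norm (t n)))"
  \<comment> \<open>If |g| is at most half of |\<gamma>|, then |\<gamma> + g| is at least the other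
    half; the same threshold is used for |f|.\<close>
  define \<eta> where "\<eta> = norm \<gamma> / 2"
  have \<eta>: "\<eta> > 0" using \<gamma> by (simp add: \<eta>_def)
  \<comment> \<open>84 = 3 * (14 + 14) combines the kernel bound with the two Kolmogorov constants;
    sqrt \<eta> cancels the division by it in the pointwise estimate.\<close>
  define \<delta> where "\<delta> = \<epsilon> * sqrt \<eta> / 84"
  have \<delta>: "\<delta> > 0" using \<epsilon> \<eta> by (simp add: \<delta>_def)
  have "\<forall>\<^sub>F R in at_top. sqrt (D b R) < \<delta> \<and> sqrt (D a R) < \<delta>"
    unfolding D_def using b_sum a_sum \<delta>
    by (intro eventually_conj sqrt_small_eventually cauchy_weights_tendsto_0)
  then obtain r1 where r1: "\<And>R. R \<ge> r1 \<Longrightarrow> sqrt (D b R) < \<delta>" "\<And>R. R \<ge> r1 \<Longrightarrow> sqrt (D a R) < \<delta>"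
    unfolding eventually_at_top_linorder by blast
  have main: "ln_pos (norm (H z)) \<le> \<epsilon> * B"
    if r: "r \<ge> max 1 r1" and B: "\<And>w. norm w \<le> 4 * r \<Longrightarrow> ln_pos (norm (H w)) \<le> B" and z: "norm z \<le> r" for r B z
  proof -
    \<comment> \<open>Zeros of A are avoided for the sake of the Cauchy transforms, zeros of H for
      Poisson--Jensen.\<close>
    obtain R where R: "2 * r < R" "R < 4 * r" and nz: "\<And>z. norm z = R \<Longrightarrow> A z \<noteq> 0" "\<And>z. norm z = R \<Longrightarrow> H z \<noteq> 0"
      using exists_zero_free_radius[OF A_entire A_nz H H_nz H H_nz, of "2 * r" "4 * r"] r by auto
    have R1: "R \<ge> 1" "R \<ge> r1" using R r by auto
    have B0: "B \<ge> 0" using B[of 0] ln_pos_nonneg[of "norm (H 0)"] r by force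
    define f where "f = (\<lambda>\<zeta>. \<Sum>n. b n / (of_real R * \<zeta> - t n))"
    define g where "g = (\<lambda>\<zeta>. \<Sum>n. a n / (of_real R * \<zeta> - t n))"
    have f: "continuous_on (sphere 0 1) f" "cmean (\<lambda>\<zeta>. sqrt (norm (f \<zeta>))) \<le> 14 * sqrt (D b R)"
      unfolding f_def D_def using F_eq by (intro circle_sum[where \<kappa> = 0, OF F _ R1(1) nz(1) b_sum]; simp)+
    have g: "continuous_on (sphere 0 1) g" "cmean (\<lambda>\<zeta>. sqrt (norm (g \<zeta>))) \<le> 14 * sqrt (D a R)"
      unfolding g_def D_def by (intro circle_sum[OF G G_eq R1(1) nz(1) a_sum]; simp)+
    define h where "h = (\<lambda>w. H (of_real R * w))"
    have h: "h holomorphic_on UNIV"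
      unfolding h_def by (rule holomorphic_on_compose_gen[OF _ H, unfolded o_def]) (auto intro: holomorphic_intros)
    have ch: "continuous_on (sphere 0 1) h"
      by (rule continuous_on_subset[OF holomorphic_on_imp_continuous_on[OF h]]) simp
    \<comment> \<open>If both transforms are at most \<open>\<eta>\<close> in modulus at \<open>\<zeta>\<close>, then \<open>\<bar>h \<zeta>\<bar> \<le> 1\<close>; otherwise the sum of roots is at least \<open>sqrt \<eta>\<close>.\<close>
    have pt: "ln_pos (norm (h \<zeta>)) \<le> B / sqrt \<eta> * (sqrt (norm (f \<zeta>)) + sqrt (norm (g \<zeta>)))"
      if \<zeta>: "norm \<zeta> = 1" for \<zeta>
    proof (cases "norm (f \<zeta>) \<le> \<eta> \<and> norm (g \<zeta>) \<le> \<eta>")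
      case True
      have nA: "A (of_real R * \<zeta>) \<noteq> 0" using nz(1)[of "of_real R * \<zeta>"] \<zeta> R1 by (simp add: norm_mult)
      then have off: "of_real R * \<zeta> \<notin> range t" using A_eq_0_iff by blast
      have "f \<zeta> = h \<zeta> * (\<gamma> + g \<zeta>)"
        using FHG[of "of_real R * \<zeta>"] F_eq[OF off] G_eq[OF off] nA by (simp add: f_def g_def h_def)
      then have "norm (h \<zeta>) * norm (\<gamma> + g \<zeta>) \<le> \<eta>" using True by (simp add: norm_mult)
      moreover have "\<eta> \<le> norm (\<gamma> + g \<zeta>)"
        using norm_triangle_ineq2[of \<gamma> "- g \<zeta>"] True by (simp add: \<eta>_def)
      ultimately have "norm (h \<zeta>) * \<eta> \<le> 1 * \<eta>" 
        using mult_left_mono[of \<eta> "norm (\<gamma> + g \<zeta>)" "norm (h \<zeta>)"] by simp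
      then have "norm (h \<zeta>) \<le> 1" using \<eta> by simp
      then show ?thesis using B0 \<eta> by (simp add: ln_pos_def)
    next
      case False
      then have "sqrt \<eta> \<le> sqrt (norm (f \<zeta>)) \<or> sqrt \<eta> \<le> sqrt (norm (g \<zeta>))" by auto
      then have "sqrt \<eta> \<le> sqrt (norm (f \<zeta>)) + sqrt (norm (g \<zeta>))"
        by (auto intro: add_increasing add_increasing2)
      then have "B / sqrt \<eta> * sqrt \<eta> \<le> B / sqrt \<eta> * (sqrt (norm (f \<zeta>)) + sqrt (norm (g \<zeta>)))"
        using B0 \<eta> by (intro mult_left_mono) auto
      moreover have "ln_pos (norm (h \<zeta>)) \<le> B"
        unfolding h_def using R R1 \<zeta> by (intro B) (simp add: norm_mult)
      ultimately show ?thesis using \<eta> by simp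
    qed
    define w where "w = z / of_real R"
    have "norm w = norm z / R" using R1 by (simp add: w_def norm_divide)
    also have "\<dots> \<le> 1/2" using R R1 z by (simp add: divide_le_eq)
    finally have w: "norm w \<le> 1/2" .
    have "ln_pos (norm (H z)) = ln_pos (norm (h w))" using R1 by (simp add: h_def w_def)
    also have "\<dots> \<le> 3 * cmean (\<lambda>\<zeta>. ln_pos (norm (h \<zeta>)))"
      using nz(2) R1 by (intro ln_pos_norm_le_cmean h w) (auto simp: h_def norm_mult)
    also have "cmean (\<lambda>\<zeta>. ln_pos (norm (h \<zeta>))) \<le> cmean (\<lambda>\<zeta>. B / sqrt \<eta> * (sqrt (norm (f \<zeta>)) + sqrt (norm (g \<zeta>))))"
      by (intro cmean_mono continuous_intros ch f g pt)
    also have "\<dots> = B / sqrt \<eta> * (cmean (\<lambda>\<zeta>. sqrt (norm (f \<zeta>))) + cmean (\<lambda>\<zeta>. sqrt (norm (g \<zeta>))))"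
      using f(1) g(1) by (subst cmean_cmul, subst cmean_add) (auto intro!: continuous_intros)
    also have "\<dots> \<le> B / sqrt \<eta> * (14 * \<delta> + 14 * \<delta>)"
      using f(2) g(2) r1[OF R1(2)] B0 \<eta> by (intro mult_left_mono add_mono) auto
    also have "3 * \<dots> = \<epsilon> * B" using \<eta> by (simp add: \<delta>_def)
    finally show ?thesis by simp
  qed
  then show ?thesis by (intro exI[of _ "max 1 r1"]) auto
qed

text \<open>On the circle log^+ |H| \<le> log^+ |F| + log^+ (1 / |G|). Jensen at the fixed point
  \<open>y\<close> bounds the mean of the last term by that of log^+ |G|, and Poisson--Jensen for H
  carries the bound to the inner disc.\<close>

lemma quotient_poly_log_growth:
  assumes F: "F holomorphic_on UNIV" and G: "G holomorphic_on UNIV" and H: "H holomorphic_on UNIV"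
    and G_eq: "\<And>z. z \<notin> range t \<Longrightarrow> G z = A z * (\<gamma> + (\<Sum>n. a n / (z - t n)))"
    and FHG: "\<And>z. F z = H z * G z"
    and H_nz: "H x \<noteq> 0" and G_nz: "G y \<noteq> 0"
    and a_sum: "summable (\<lambda>n. norm (a n) / (norm (t n) + 1))"
    and growth: "poly_log_growth F" "poly_log_growth A" and A_nz: "A u \<noteq> 0"
  shows "poly_log_growth H"
proof -
  obtain C1 m1 where F_gr: "\<And>z. ln_pos (norm (F z)) \<le> C1 * (1 + norm z) ^ m1"
    using growth(1) unfolding poly_log_growth_def by blast
  obtain C2 m2 where A_gr: "\<And>z. ln_pos (norm (A z)) \<le> C2 * (1 + norm z) ^ m2"
    using growth(2) unfolding poly_log_growth_def by blast
  have C: "C1 \<ge> 0" "C2 \<ge> 0"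
    using F_gr[of 0] A_gr[of 0] ln_pos_nonneg[of "norm (F 0)"] ln_pos_nonneg[of "norm (A 0)"] by auto
  define D where "D = (\<lambda>R. \<Sum>n. norm (a n) / max R (norm (t n)))"
  have "\<forall>\<^sub>F R in at_top. sqrt (D R) < 1"
    unfolding D_def using a_sum by (intro sqrt_small_eventually cauchy_weights_tendsto_0) auto
  then obtain r1 where r1: "\<And>R. R \<ge> r1 \<Longrightarrow> sqrt (D R) < 1"
    unfolding eventually_at_top_linorder by blast
  \<comment> \<open>\<open>r0 \<ge> norm y\<close> puts \<open>y / of_real R\<close> in the half
    disc for every circle used. In \<open>K\<close>, 28 = 2 * 14 stems from
    \<open>ln_pos x \<le> 2 * sqrt x\<close> and Kolmogorov's bound with
    \<open>sqrt (D R) < 1\<close>; 9 and 3 stem from the estimate for the inverse.\<close>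
  define r0 where "r0 = max (max 1 r1) (norm y)"
  define K where "K = 9 * (2 * sqrt (norm \<gamma>) + 28) + 3 * \<bar>ln (norm (G y))\<bar>"
  have K: "K \<ge> 0" by (simp add: K_def)
  have main: "ln_pos (norm (H z)) \<le> 3 * (C1 * (1 + 4 * r) ^ m1 + 9 * (C2 * (1 + 4 * r) ^ m2) + K)"
    if r: "r \<ge> r0" and z: "norm z \<le> r" for r z
  proof -
    have rr: "r \<ge> 1" "r \<ge> r1" "r \<ge> norm y" using r by (auto simp: r0_def)
    obtain R where R: "2 * r < R" "R < 4 * r" and nz: "\<And>z. norm z = R \<Longrightarrow> A z \<noteq> 0" "\<And>z. norm z = R \<Longrightarrow> G z \<noteq> 0"
       "\<And>z. norm z = R \<Longrightarrow> H z \<noteq> 0"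
      using exists_zero_free_radius[OF A_entire A_nz G G_nz H H_nz, of "2 * r" "4 * r"] rr by auto
    have R1: "R \<ge> 1" "R \<ge> r1" using R rr by auto
    define g where "g = (\<lambda>\<zeta>. \<Sum>n. a n / (of_real R * \<zeta> - t n))"
    have g: "continuous_on (sphere 0 1) g" "cmean (\<lambda>\<zeta>. sqrt (norm (g \<zeta>))) \<le> 14 * sqrt (D R)"
      unfolding g_def D_def by (intro circle_sum[OF G G_eq R1(1) nz(1) a_sum]; simp)+
    have scale: "(\<lambda>w. k (of_real R * w)) holomorphic_on UNIV" if "k holomorphic_on UNIV" for k
      by (rule holomorphic_on_compose_gen[OF _ that, unfolded o_def]) (auto intro: holomorphic_intros)
    have cont: "continuous_on (sphere 0 1) (\<lambda>w. k (of_real R * w))" if "k holomorphic_on UNIV" for k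
      by (rule continuous_on_subset[OF holomorphic_on_imp_continuous_on[OF scale[OF that]]]) simp
    have inner: "norm (v / of_real R) \<le> 1/2" if "norm v \<le> r" for v :: complex
      using R R1 that by (simp add: norm_divide divide_le_eq)
    have nR: "norm (of_real R * \<zeta>) = R" if "norm \<zeta> = 1" for \<zeta> :: complex
      using that R1 by (simp add: norm_mult)
    let ?M = "\<lambda>k. cmean (\<lambda>\<zeta>. ln_pos (norm (k (of_real R * \<zeta>))))"
    have "(1 + R) ^ m \<le> (1 + 4 * r) ^ m" for m using R R1 by (intro power_mono) auto
    then have pw: "C * (1 + R) ^ m \<le> C * (1 + 4 * r) ^ m" if "C \<ge> 0" for C m
      using that by (intro mult_left_mono) auto
    have MF: "?M F \<le> C1 * (1 + 4 * r) ^ m1"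
    proof -
      have "?M F \<le> cmean (\<lambda>\<zeta>. C1 * (1 + R) ^ m1)"
        using F_gr nR by (intro cmean_mono continuous_intros cont F) metis
      then show ?thesis using pw[OF C(1), of m1] by (simp add: cmean_const)
    qed
    have MA: "?M A \<le> C2 * (1 + 4 * r) ^ m2"
    proof -
      have "?M A \<le> cmean (\<lambda>\<zeta>. C2 * (1 + R) ^ m2)"
        using A_gr nR by (intro cmean_mono continuous_intros cont A_entire) metis
      then show ?thesis using pw[OF C(2), of m2] by (simp add: cmean_const)
    qed
    \<comment> \<open>No growth bound is assumed for G. It is A times \<gamma> + g on the circle,
      and the second factor is controlled in the mean through the square root.\<close>
    have MG: "?M G \<le> C2 * (1 + 4 * r) ^ m2 + 2 * sqrt (norm \<gamma>) + 28"
    proof -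
      have "?M G \<le> cmean (\<lambda>\<zeta>. ln_pos (norm (A (of_real R * \<zeta>))) + (2 * sqrt (norm \<gamma>) + 2 * sqrt (norm (g \<zeta>))))"
      proof (rule cmean_mono)
        fix \<zeta> :: complex assume \<zeta>: "norm \<zeta> = 1"
        have off: "of_real R * \<zeta> \<notin> range t" using nz(1)[OF nR[OF \<zeta>]] A_eq_0_iff by blast
        have "ln_pos (norm (G (of_real R * \<zeta>))) = ln_pos (norm (A (of_real R * \<zeta>)) * norm (\<gamma> + g \<zeta>))"
          by (simp add: G_eq[OF off] g_def norm_mult)
        also have "\<dots> \<le> ln_pos (norm (A (of_real R * \<zeta>))) + ln_pos (norm (\<gamma> + g \<zeta>))"
          by (intro ln_pos_mult_le) auto
        also have "ln_pos (norm (\<gamma> + g \<zeta>)) \<le> 2 * sqrt (norm (\<gamma> + g \<zeta>))" by (intro ln_pos_le_sqrt) auto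
        also have "\<dots> \<le> 2 * sqrt (norm \<gamma>) + 2 * sqrt (norm (g \<zeta>))" using sqrt_norm_add_le[of \<gamma> "g \<zeta>"] by simp
        finally show "ln_pos (norm (G (of_real R * \<zeta>))) \<le>
           ln_pos (norm (A (of_real R * \<zeta>))) + (2 * sqrt (norm \<gamma>) + 2 * sqrt (norm (g \<zeta>)))" by simp
      qed (intro continuous_intros cont G A_entire g)+
      also have "\<dots> = ?M A + cmean (\<lambda>\<zeta>. 2 * sqrt (norm \<gamma>) + 2 * sqrt (norm (g \<zeta>)))"
        by (intro cmean_add continuous_intros cont A_entire g)
      also have "cmean (\<lambda>\<zeta>. 2 * sqrt (norm \<gamma>) + 2 * sqrt (norm (g \<zeta>))) =
          2 * sqrt (norm \<gamma>) + 2 * cmean (\<lambda>\<zeta>. sqrt (norm (g \<zeta>)))"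
        using g(1) by (subst cmean_add) (auto simp: cmean_cmul cmean_const intro!: continuous_intros)
      finally show ?thesis using MA g(2) r1[OF R1(2)] by linarith
    qed
    have Gy: "cmean (\<lambda>\<zeta>. ln_pos (1 / norm (G (of_real R * \<zeta>)))) \<le> 9 * ?M G - 3 * ln (norm (G y))"
    proof -
      have "cmean (\<lambda>\<zeta>. ln_pos (1 / norm (G (of_real R * \<zeta>)))) \<le>
          9 * ?M G - 3 * ln (norm (G (of_real R * (y / of_real R))))"
        by (rule cmean_ln_pos_inverse_le[OF scale[OF G]])
           (use nz(2)[OF nR] inner[OF rr(3)] G_nz R1 in auto)
      then show ?thesis using R1 by simp
    qed
    have "ln_pos (norm (H (of_real R * (z / of_real R)))) \<le> 3 * ?M H"
      by (rule ln_pos_norm_le_cmean[OF scale[OF H]]) (use nz(3)[OF nR] inner[OF z] in auto)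
    then have Hz: "ln_pos (norm (H z)) \<le> 3 * ?M H" using R1 by simp
    have "?M H \<le> cmean (\<lambda>\<zeta>. ln_pos (norm (F (of_real R * \<zeta>))) + ln_pos (1 / norm (G (of_real R * \<zeta>))))"
    proof (rule cmean_mono)
      show "continuous_on (sphere 0 1) (\<lambda>\<zeta>. ln_pos (norm (F (of_real R * \<zeta>))) + ln_pos (1 / norm (G (of_real R * \<zeta>))))"
        using nz(2) nR by (intro continuous_intros cont F G) auto
      fix \<zeta> :: complex assume \<zeta>: "norm \<zeta> = 1"
      have "norm (H (of_real R * \<zeta>)) = norm (F (of_real R * \<zeta>)) * (1 / norm (G (of_real R * \<zeta>)))"
        using nz(2)[OF nR[OF \<zeta>]] by (simp add: FHG norm_mult)
      then show "ln_pos (norm (H (of_real R * \<zeta>))) \<le>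
          ln_pos (norm (F (of_real R * \<zeta>))) + ln_pos (1 / norm (G (of_real R * \<zeta>)))"
        using ln_pos_mult_le[of "norm (F (of_real R * \<zeta>))" "1 / norm (G (of_real R * \<zeta>))"] by simp
    qed (intro continuous_intros cont H)
    also have "\<dots> = ?M F + cmean (\<lambda>\<zeta>. ln_pos (1 / norm (G (of_real R * \<zeta>))))"
      using nz(2) nR by (intro cmean_add continuous_intros cont F G) auto
    finally have MH: "?M H \<le> ?M F + cmean (\<lambda>\<zeta>. ln_pos (1 / norm (G (of_real R * \<zeta>))))" .
    have "x \<le> 3 * (c + 9 * d + (9 * (2 * s + 28) + 3 * \<bar>l\<bar>))"
      if "x \<le> 3 * h" "h \<le> f + g" "f \<le> c" "k \<le> d + 2 * s + 28" "g \<le> 9 * k - 3 * l"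
      for x h f g c d k s l :: real
      using that by argo
    from this[OF Hz MH MF MG Gy] show ?thesis by (simp only: K_def)
  qed
  define m where "m = max m1 m2"
  define C where "C = 3 * (C1 + 9 * C2 + K)"
  have C0: "C \<ge> 0" using C K by (simp add: C_def)
  have "ln_pos (norm (H z)) \<le> (C * (5 * r0) ^ m) * (1 + norm z) ^ m" for z
  proof -
    \<comment> \<open>A single bound covers all z: points with |z| < \<open>r0\<close> are treated
      at radius \<open>r0\<close>, and r \<le> r0 (1 + |z|) gives 1 + 4 r \<le> 5 r0 (1 +
      |z|).\<close>
    define r where "r = max r0 (norm z)"
    have r0: "r0 \<ge> 1" by (simp add: r0_def)
    have r: "r \<ge> r0" "norm z \<le> r" by (auto simp: r_def)
    have pw: "(1 + 4 * r) ^ k \<le> (1 + 4 * r) ^ m" if "k \<le> m" for k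
      using that r r0 by (intro power_increasing) auto
    have pm: "1 \<le> (1 + 4 * r) ^ m" using r r0 by (intro one_le_power) auto
    have "ln_pos (norm (H z)) \<le> 3 * (C1 * (1 + 4 * r) ^ m1 + 9 * (C2 * (1 + 4 * r) ^ m2) + K * 1)"
      using main[OF r] by simp
    also have "\<dots> \<le> 3 * (C1 * (1 + 4 * r) ^ m + 9 * (C2 * (1 + 4 * r) ^ m) + K * (1 + 4 * r) ^ m)"
      using C K pm by (intro mult_left_mono add_mono pw) (auto simp: m_def)
    also have "\<dots> = C * (1 + 4 * r) ^ m" by (simp add: C_def algebra_simps)
    also have "\<dots> \<le> C * (5 * r0 * (1 + norm z)) ^ m"
    proof (intro mult_left_mono power_mono)
      have "r \<le> r0 * (1 + norm z)"
        using r0 mult_right_mono[of 1 r0 "norm z"] unfolding r_def max.bounded_iff distrib_left by auto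
      then show "1 + 4 * r \<le> 5 * r0 * (1 + norm z)" using r r0 by linarith
    qed (use C0 r r0 in auto)
    finally show ?thesis by (simp only: power_mult_distrib mult_ac)
  qed
  then show ?thesis unfolding poly_log_growth_def by blast
qed

end

section \<open>The constant term, elements of the space, and the contradiction\<close>

context cauchy_de_branges
begin

text \<open>On circles avoiding the \<open>t n\<close> the series has constant modulus |\<kappa>|,
  so its half-power mean is sqrt |\<kappa>|, while Kolmogorov's bound tends to 0. This shows both
  that G is not identically zero and, at the end, that the constant quotient is 0.\<close>

lemma cauchy_transform_constant_term:
  assumes eq: "\<And>z. z \<notin> range t \<Longrightarrow> \<kappa> + (\<Sum>n. d n / (z - t n)) = 0"
    and sum: "summable (\<lambda>n. norm (d n) / (norm (t n) + 1))" and A_nz: "A u \<noteq> 0"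
  shows "\<kappa> = 0"
proof (rule ccontr)
  assume "\<kappa> \<noteq> 0"
  define D where "D = (\<lambda>R. \<Sum>n. norm (d n) / max R (norm (t n)))"
  have "\<forall>\<^sub>F R in at_top. sqrt (D R) < sqrt (norm \<kappa>) / 14"
    unfolding D_def using sum \<open>\<kappa> \<noteq> 0\<close> by (intro sqrt_small_eventually cauchy_weights_tendsto_0) auto
  then obtain r1 where r1: "\<And>R. R \<ge> r1 \<Longrightarrow> sqrt (D R) < sqrt (norm \<kappa>) / 14"
    unfolding eventually_at_top_linorder by blast
  obtain R where R: "max 1 r1 < R" and nz: "\<And>z. norm z = R \<Longrightarrow> A z \<noteq> 0"
    using exists_zero_free_radius[OF A_entire A_nz A_entire A_nz A_entire A_nz, of "max 1 r1" "max 1 r1 + 1"] by auto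
  have "norm (\<Sum>n. d n / (of_real R * \<zeta> - t n)) = norm \<kappa>" if "norm \<zeta> = 1" for \<zeta>
  proof -
    have "A (of_real R * \<zeta>) \<noteq> 0" using nz[of "of_real R * \<zeta>"] that R by (simp add: norm_mult)
    then have "of_real R * \<zeta> \<notin> range t" using A_eq_0_iff by blast
    from eq[OF this] show ?thesis by (metis add_eq_0_iff norm_minus_cancel)
  qed
  then have "sqrt (norm \<kappa>) = cmean (\<lambda>\<zeta>. sqrt (norm (\<Sum>n. d n / (of_real R * \<zeta> - t n))))"
    by (subst cmean_cong[where \<psi> = "\<lambda>_. sqrt (norm \<kappa>)"]) (simp_all add: cmean_const)
  also have "\<dots> \<le> 14 * sqrt (D R)"
    unfolding D_def by (rule circle_sum(2)[where F = "\<lambda>_. 0" and \<kappa> = \<kappa>]) (use eq R nz sum in auto)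
  also have "\<dots> < sqrt (norm \<kappa>)" using r1[of R] R by simp
  finally show False by simp
qed

end

text \<open>The inequality x y \<le> x^2 + y^2, applied termwise with (|t n| + 1)^2 \<ge> |t n|^2 +
  1, puts the coefficients of F under the same summability condition as \<open>a\<close>.\<close>

lemma l2_weight_summable:
  fixes c :: "nat \<Rightarrow> complex" and t :: "nat \<Rightarrow> complex" and \<mu> :: "nat \<Rightarrow> real"
  assumes \<mu>: "\<And>n. \<mu> n > 0" and \<mu>_sum: "summable (\<lambda>n. \<mu> n / ((norm (t n))\<^sup>2 + 1))"
    and c: "summable (\<lambda>n. (norm (c n))\<^sup>2)"
  shows "summable (\<lambda>n. norm (c n * of_real (sqrt (\<mu> n))) / (norm (t n) + 1))"
proof (rule summable_comparison_test)
  show "summable (\<lambda>n. (norm (c n))\<^sup>2 + \<mu> n / ((norm (t n))\<^sup>2 + 1))"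
    by (intro summable_add c \<mu>_sum)
  have "norm (c n * of_real (sqrt (\<mu> n))) / (norm (t n) + 1) \<le> (norm (c n))\<^sup>2 + \<mu> n / ((norm (t n))\<^sup>2 + 1)" for n
  proof -
    define y where "y = sqrt (\<mu> n) / (norm (t n) + 1)"
    have p: "norm (t n) + 1 > 0" by (simp add: add_nonneg_pos)
    have y: "y \<ge> 0" using \<mu>[of n] by (simp add: y_def)
    have "norm (c n * of_real (sqrt (\<mu> n))) / (norm (t n) + 1) = norm (c n) * y"
      using \<mu>[of n] by (simp add: y_def norm_mult)
    also have "\<dots> \<le> (norm (c n))\<^sup>2 + y\<^sup>2"
    proof -
      have "0 \<le> (norm (c n) - y)\<^sup>2" by simp
      then have "2 * (norm (c n) * y) \<le> (norm (c n))\<^sup>2 + y\<^sup>2"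
        by (simp add: power2_eq_square algebra_simps)
      moreover have "0 \<le> norm (c n) * y" using y by simp
      ultimately show ?thesis by linarith
    qed
    also have "y\<^sup>2 = \<mu> n / (norm (t n) + 1)\<^sup>2" using \<mu>[of n] by (simp add: y_def power_divide)
    also have "\<dots> \<le> \<mu> n / ((norm (t n))\<^sup>2 + 1)"
    proof (intro divide_left_mono mult_pos_pos)
      show "(norm (t n))\<^sup>2 + 1 \<le> (norm (t n) + 1)\<^sup>2" by (simp add: power2_eq_square algebra_simps)
      show "0 < (norm (t n))\<^sup>2 + 1" by (simp add: add_nonneg_pos)
    qed (use \<mu>[of n] p in auto)
    finally show ?thesis by simp
  qed
  then show "\<exists>N. \<forall>n\<ge>N. norm (norm (c n * of_real (sqrt (\<mu> n))) / (norm (t n) + 1)) \<le> (norm (c n))\<^sup>2 + \<mu> n / ((norm (t n))\<^sup>2 + 1)"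
    by simp
qed

text \<open>Finite order is postulated for elements of the space, and A need not be one; A(z) / (z -
  t m) is, with a coefficient sequence supported at m that cancels \<open>sqrt (\<mu> m)\<close>.
  Its value at \<open>t m\<close> is the derivative of A.\<close>

lemma CdB_space_divided_generator:
  assumes A: "A holomorphic_on UNIV" "A (t m) = 0" and \<mu>: "\<mu> m > 0"
  obtains F where "F \<in> CdB_space t A \<mu>" "\<And>z. A z = (z - t m) * F z"
proof -
  define F where "F = (\<lambda>z. if z = t m then deriv A (t m) else A z / (z - t m))"
  have "F holomorphic_on UNIV"
    using pole_theorem[OF A(1), of "t m" "\<lambda>z. A z / (z - t m)"] A(2)
    unfolding F_def by (simp cong: if_cong)
  define c :: "nat \<Rightarrow> complex" where "c = (\<lambda>n. if n = m then 1 / of_real (sqrt (\<mu> m)) else 0)"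
  have "summable (\<lambda>n. (norm (c n))\<^sup>2)"
    by (rule summable_finite[of "{m}"]) (auto simp: c_def)
  moreover have "F z = A z * (\<Sum>n. c n * of_real (sqrt (\<mu> n)) / (z - t n))" if "z \<notin> range t" for z
  proof -
    have "(\<Sum>n. c n * of_real (sqrt (\<mu> n)) / (z - t n)) = (\<Sum>n\<in>{m}. c n * of_real (sqrt (\<mu> n)) / (z - t n))"
      by (rule suminf_finite) (auto simp: c_def)
    also have "\<dots> = 1 / (z - t m)" using \<mu> by (simp add: c_def)
    finally show ?thesis using that by (auto simp: F_def)
  qed
  ultimately have "F \<in> CdB_space t A \<mu>"
    unfolding CdB_space_def using \<open>F holomorphic_on UNIV\<close> by blast
  moreover have "A z = (z - t m) * F z" for z using A(2) by (simp add: F_def)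
  ultimately show ?thesis using that by blast
qed

theorem theorem3p2:
  fixes t :: "nat \<Rightarrow> complex" and \<mu> :: "nat \<Rightarrow> real"
    and A G :: "complex \<Rightarrow> complex" and \<gamma> :: complex and a :: "nat \<Rightarrow> complex"
  assumes t_inj: "inj t"
    and t_inf: "filterlim (\<lambda>n. norm (t n)) at_top sequentially"
    and \<mu>_pos: "\<And>n. \<mu> n > 0"
    and \<mu>_sum: "summable (\<lambda>n. \<mu> n / ((norm (t n))\<^sup>2 + 1))"
    and A_entire: "A holomorphic_on UNIV"
    and A_zeros: "{z. A z = 0} = range t"
    and A_simple: "\<And>n. deriv A (t n) \<noteq> 0"
    and fin_order: "\<forall>F \<in> CdB_space t A \<mu>. entire_finite_order F"
    and \<gamma>_nz: "\<gamma> \<noteq> 0"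
    and a_sum: "summable (\<lambda>n. norm (a n) / (norm (t n) + 1))"
    and G_entire: "G holomorphic_on UNIV"
    and G_def: "\<And>z. z \<notin> range t \<Longrightarrow> G z = A z * (\<gamma> + (\<Sum>n. a n / (z - t n)))"
    and F_in: "F \<in> CdB_space t A \<mu>"
    and F_vanish: "\<And>z k. (\<forall>j\<le>k. (deriv ^^ j) G z = 0) \<Longrightarrow> (deriv ^^ k) F z = 0"
  shows "F = (\<lambda>z. 0)"
proof (rule ccontr)
  assume F_nz: "F \<noteq> (\<lambda>z. 0)"
  interpret cauchy_de_branges t A
    by unfold_locales (fact t_inf A_entire A_zeros)+
  obtain u where A_nz: "A u \<noteq> 0"
  proof -
    have "A \<noteq> (\<lambda>_. 0)" using A_simple[of 0] by auto
    then show ?thesis using that by blast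
  qed
  obtain c where c: "summable (\<lambda>n. (cmod (c n))\<^sup>2)" and F_entire: "F holomorphic_on UNIV"
    and F_sum: "\<And>z. z \<notin> range t \<Longrightarrow> F z = A z * (\<Sum>n. c n * complex_of_real (sqrt (\<mu> n)) / (z - t n))"
    using F_in unfolding CdB_space_def by blast
  define b where "b = (\<lambda>n. c n * complex_of_real (sqrt (\<mu> n)))"
  have F_eq: "F z = A z * (\<Sum>n. b n / (z - t n))" if "z \<notin> range t" for z
    using F_sum[OF that] by (simp add: b_def)
  have b_sum: "summable (\<lambda>n. norm (b n) / (norm (t n) + 1))"
    unfolding b_def by (rule l2_weight_summable[OF \<mu>_pos \<mu>_sum c])
  have F_growth: "poly_log_growth F"
    using fin_order F_in by (intro finite_order_imp_poly_log_growth) auto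
  have A_growth: "poly_log_growth A"
  proof -
    have At0: "A (t 0) = 0" using A_eq_0_iff by blast
    obtain F0 where F0: "F0 \<in> CdB_space t A \<mu>" "\<And>z. A z = (z - t 0) * F0 z"
      by (rule CdB_space_divided_generator[where t = t and m = 0 and \<mu> = \<mu>, OF A_entire At0 \<mu>_pos]) (rule that)
    have "poly_log_growth F0"
      using fin_order F0(1) by (intro finite_order_imp_poly_log_growth) blast
    then show ?thesis
      by (rule poly_log_growth_mult_linear[of F0 A "t 0"]) (subst F0(2), simp add: norm_mult)
  qed
  obtain y where G_nz: "G y \<noteq> 0"
  proof (rule ccontr)
    assume "\<not> thesis"
    then have "G z = 0" for z using that by blast
    then have "\<gamma> + (\<Sum>n. a n / (z - t n)) = 0" if "z \<notin> range t" for z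
      using G_def[OF that] that A_eq_0_iff[of z] by simp
    from cauchy_transform_constant_term[OF this a_sum A_nz] show False using \<gamma>_nz by simp
  qed
  obtain H where H: "H holomorphic_on UNIV" and FHG: "\<And>z. F z = H z * G z"
    by (rule entire_quotient[OF F_entire G_entire G_nz F_vanish]) (assumption, rule that)
  obtain x where H_nz: "H x \<noteq> 0" using F_nz FHG by fastforce
  have "poly_log_growth H"
    by (rule quotient_poly_log_growth[OF F_entire G_entire H G_def FHG H_nz G_nz a_sum F_growth A_growth A_nz])
  then have bound: "norm (H z) \<le> 1" for z
    by (rule poly_log_growth_contraction)
       (rule quotient_growth_contraction[OF F_entire G_entire H F_eq G_def FHG \<gamma>_nz H_nz b_sum a_sum _ A_nz])
  then have "bounded (range H)" by (auto simp: bounded_iff)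
  then obtain k where k: "\<And>z. H z = k"
    using Liouville_theorem[OF H] unfolding constant_on_def by auto
  \<comment> \<open>The relation F = k G divided by A is the vanishing of one Cauchy transform with
    coefficients b n - k a n and constant term - k \<gamma>.\<close>
  have "- k * \<gamma> + (\<Sum>n. (b n - k * a n) / (z - t n)) = 0" if z: "z \<notin> range t" for z
  proof -
    have sa: "summable (\<lambda>n. a n / (z - t n))" and sb: "summable (\<lambda>n. b n / (z - t n))"
      by (intro cauchy_transform_summable t_inf a_sum b_sum)+
    have "(\<Sum>n. (b n - k * a n) / (z - t n)) = (\<Sum>n. b n / (z - t n) - k * (a n / (z - t n)))"
      by (simp add: diff_divide_distrib)
    also have "\<dots> = (\<Sum>n. b n / (z - t n)) - k * (\<Sum>n. a n / (z - t n))"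
      by (simp only: suminf_diff[OF sb summable_mult[OF sa], symmetric] suminf_mult[OF sa, symmetric])
    also have "(\<Sum>n. b n / (z - t n)) = k * (\<gamma> + (\<Sum>n. a n / (z - t n)))"
      using FHG[of z] F_eq[OF z] G_def[OF z] k[of z] z A_eq_0_iff[of z] by simp
    finally show ?thesis by (simp add: algebra_simps)
  qed
  moreover have "summable (\<lambda>n. norm (b n - k * a n) / (norm (t n) + 1))"
  proof (rule summable_comparison_test)
    show "summable (\<lambda>n. norm (b n) / (norm (t n) + 1) + norm k * (norm (a n) / (norm (t n) + 1)))"
      by (intro summable_add summable_mult a_sum b_sum)
    have "norm (b n - k * a n) / (norm (t n) + 1) \<le> norm (b n) / (norm (t n) + 1) + norm k * (norm (a n) / (norm (t n) + 1))" for n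
      using divide_right_mono[OF norm_triangle_ineq4[of "b n" "k * a n"], of "norm (t n) + 1"]
      by (simp add: norm_mult add_divide_distrib)
    then show "\<exists>N. \<forall>n\<ge>N. norm (norm (b n - k * a n) / (norm (t n) + 1)) \<le>
        norm (b n) / (norm (t n) + 1) + norm k * (norm (a n) / (norm (t n) + 1))"
      by simp
  qed
  ultimately have "- k * \<gamma> = 0" by (rule cauchy_transform_constant_term[OF _ _ A_nz])
  then show False using \<gamma>_nz k H_nz by simp
qed

end
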